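(* Let $G$ be a finite simple graph of maximum degree $6$. Then $\chi^t_{\mathrm P}(G)\le 2$; that is, there is a map $\ell: V(G)\cup E(G)\to\{1,2\}$ such that for every edge $uv$ of $G$ we have $\pi_\ell(u)\neq\pi_\ell(v)$, where $\pi_\ell(w)=\ell(w)\cdot\prod_{x\in N(w)}\ell(wx)$.
   Context: A total $k$-labelling of a graph $G$ is a map $\ell: V(G)\cup E(G)\to\{1,\dots,k\}$. For a vertex $w$, $\pi_\ell(w)$ denotes the product of the label of $w$ and the labels of all edges incident to $w$. The labelling is product-proper if $\pi_\ell(u)\ne\pi_\ell(v)$ for every edge $uv$. $\chi^t_{\mathrm P}(G)$ is the smallest $k\ge1$ such that $G$ admits a product-proper total $k$-labelling. *)

theory Defs
  imports Main "HOL-Library.FuncSet"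
begin

locale fin_simple_graph =
  fixes V :: "'a set" and E :: "'a set set"
  assumes finite_vertices: "finite V"
    and edges: "\<And>e. e \<in> E \<Longrightarrow> e \<subseteq> V \<and> card e = 2"

definition neighbours :: "'a set set \<Rightarrow> 'a \<Rightarrow> 'a set" where
  "neighbours E w = {x. {w, x} \<in> E}"

definition degree :: "'a set set \<Rightarrow> 'a \<Rightarrow> nat" where
  "degree E w = card (neighbours E w)"

text \<open>The inserted 0 only matters for the graph without vertices, whose maximum degree is 0.\<close>

definition max_degree :: "'a set \<Rightarrow> 'a set set \<Rightarrow> nat" where
  "max_degree V E = Max (insert 0 (degree E ` V))"

text \<open>Vertices and edges have different types, so a total labelling is a single map on the
  disjoint sum \<^term>\<open>V <+> E\<close>: the label of a vertex \<open>w\<close> is \<open>l (Inl w)\<close>, the label of an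
  edge \<open>e\<close> is \<open>l (Inr e)\<close>.\<close>

definition total_labelling :: "'a set \<Rightarrow> 'a set set \<Rightarrow> nat \<Rightarrow> ('a + 'a set \<Rightarrow> nat) \<Rightarrow> bool" where
  "total_labelling V E k l \<longleftrightarrow> l \<in> (V <+> E) \<rightarrow> {1..k}"

definition label_product :: "'a set set \<Rightarrow> ('a + 'a set \<Rightarrow> nat) \<Rightarrow> 'a \<Rightarrow> nat" where
  "label_product E l w = l (Inl w) * (\<Prod>e\<in>{e \<in> E. w \<in> e}. l (Inr e))"

definition product_proper :: "'a set set \<Rightarrow> ('a + 'a set \<Rightarrow> nat) \<Rightarrow> bool" where
  "product_proper E l \<longleftrightarrow>
     (\<forall>u v. {u, v} \<in> E \<longrightarrow> label_product E l u \<noteq> label_product E l v)"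

definition total_product_chromatic_number :: "'a set \<Rightarrow> 'a set set \<Rightarrow> nat" where
  "total_product_chromatic_number V E =
     (LEAST k. k \<ge> 1 \<and> (\<exists>l. total_labelling V E k l \<and> product_proper E l))"

end

theory Submission
  imports Defs
begin

text \<open>
With labels 1 and 2 only the number of labels 2 at a vertex matters, so we need a set \<open>F\<close> of
edges and numbers \<open>f v \<in> {deg\<^sub>F v, deg\<^sub>F v + 1}\<close> that differ on every edge. Take a maximum cut and give
\<open>f\<close> even values on one side and odd values on the other: only edges inside a side can conflict, and
\<open>f v\<close> is \<open>deg\<^sub>F v\<close> rounded up to the parity of the side. For a maximum cut, any orientation of the
edges inside the sides (the tail of an edge \<^emph>\<open>pays\<close> for it) extends to an almost Eulerian
orientation of the graph. Putting into \<open>F\<close> the cut edges leaving the even side makes the number of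
chosen cut edges at \<open>v\<close> equal to \<open>d v / 2\<close> minus the number of edges paid by \<open>v\<close>, up to a rounding
error at odd vertices which is not under control, except that for disjoint pairs of odd vertices one
combination of errors per pair can be excluded. An edge inside a side that is paid by one end and
put into \<open>F\<close> or not thus changes the value of one end by one in either direction and keeps that of
the other end, so the sides can be coloured greedily along a ranking of their vertices.

Odd vertices must be insensitive to their rounding error. A vertex of degree 5 on the odd side is so
without using any edge, one on the even side after using one edge; for degree 3 the roles are
exchanged. Since a vertex has at most half of its neighbours on its own side, suitable rankings exist
for maximum degree 6, after deleting from the even side an independent set of vertices of degree 5 in
order to break long paths and cycles of odd vertices. The deleted vertices get \<open>f = 0\<close>.
\<close>

section \<open>Orientations with prescribed balance\<close>

text \<open>A pair in \<open>B\<close> is an edge with a reference direction; a negative value of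
  \<open>\<phi>\<close> is flow against that direction.\<close>

definition outflow :: "('a \<times> 'a) set \<Rightarrow> ('a \<times> 'a \<Rightarrow> int) \<Rightarrow> 'a \<Rightarrow> int" where
  "outflow B \<phi> v = (\<Sum>b\<in>B. of_bool (fst b = v) * \<phi> b) - (\<Sum>b\<in>B. of_bool (snd b = v) * \<phi> b)"

definition separated :: "('a \<times> 'a) set \<Rightarrow> 'a set \<Rightarrow> int" where
  "separated B X = (\<Sum>b\<in>B. of_bool ((fst b \<in> X) \<noteq> (snd b \<in> X)))"

lemma outflow_insert:
  assumes "finite B" "b \<notin> B"
  shows "outflow (insert b B) \<phi> v =
    outflow B \<phi> v + (of_bool (fst b = v) - of_bool (snd b = v)) * \<phi> b"
  using assms by (simp add: outflow_def algebra_simps)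

lemma outflow_cong:
  assumes "\<And>b. b \<in> B \<Longrightarrow> \<phi> b = \<psi> b"
  shows "outflow B \<phi> v = outflow B \<psi> v"
  using assms by (simp add: outflow_def)

lemma separated_insert:
  assumes "finite B" "b \<notin> B"
  shows "separated (insert b B) X = separated B X + of_bool ((fst b \<in> X) \<noteq> (snd b \<in> X))"
  using assms by (simp add: separated_def)

text \<open>Submodularity of the cut function, checked edge by edge; it uncrosses two sets that
  bound a flow value from opposite sides.\<close>

lemma separated_submodular:
  "separated B (X \<inter> Y) + separated B (X \<union> Y) \<le> separated B X + separated B Y"
  unfolding separated_def sum.distrib[symmetric] by (intro sum_mono) auto

text \<open>Feasibility of integral flows with supplies \<open>M\<close> and capacity 1 in both
  directions. Edges are removed one by one: each set separating the ends of an edge bounds its flow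
  from below or above, and submodularity makes these bounds compatible.\<close>

lemma exists_bounded_flow:
  fixes M :: "'a \<Rightarrow> int"
  assumes "finite V" "finite B" "B \<subseteq> V \<times> V" "sum M V = 0"
    and "\<And>X. X \<subseteq> V \<Longrightarrow> sum M X \<le> separated B X"
  shows "\<exists>\<phi>. (\<forall>b\<in>B. \<phi> b \<in> {-1, 0, 1}) \<and> (\<forall>v\<in>V. outflow B \<phi> v = M v)"
  using assms(2-5)
proof (induction B arbitrary: M rule: finite_induct)
  case empty
  have "M v = 0" if "v \<in> V" for v
  proof -
    have "sum M {v} \<le> 0" "sum M (V - {v}) \<le> 0"
      using empty.prems(3)[of "{v}"] empty.prems(3)[of "V - {v}"] that by (auto simp: separated_def)
    moreover have "sum M V = M v + sum M (V - {v})"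
      using that assms(1) by (simp add: sum.remove)
    ultimately show ?thesis using empty.prems by simp
  qed
  then show ?case by (auto simp: outflow_def)
next
  case (insert b B)
  obtain s t where b: "b = (s, t)" by (cases b)
  have st: "s \<in> V" "t \<in> V" using insert.prems b by auto
  have sep: "separated (insert b B) X = separated B X + of_bool ((s \<in> X) \<noteq> (t \<in> X))" for X
    using separated_insert[OF insert.hyps] b by simp
  \<comment> \<open>The lower bounds on the flow through \<open>b\<close>: -1 from the capacity, the
    others from sets that contain \<open>s\<close> but not \<open>t\<close>. The largest one is
    taken as value.\<close>
  define A where "A = insert (-1) ((\<lambda>X. sum M X - separated B X) ` {X \<in> Pow V. s \<in> X \<and> t \<notin> X})"
  have finA: "finite A" using assms(1) by (simp add: A_def)
  define c where "c = Max A"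
  have cA: "c \<in> A" unfolding c_def by (rule Max_in[OF finA]) (simp add: A_def)
  then have c_cases: "c = -1 \<or> (\<exists>X. X \<subseteq> V \<and> s \<in> X \<and> t \<notin> X \<and> c = sum M X - separated B X)"
    by (auto simp: A_def)
  have c2: "-1 \<le> c" unfolding c_def by (rule Max_ge[OF finA]) (simp add: A_def)
  have c3: "sum M X - separated B X \<le> c" if "X \<subseteq> V" "s \<in> X" "t \<notin> X" for X
  proof -
    have "sum M X - separated B X \<in> A" unfolding A_def using that by blast
    then show ?thesis unfolding c_def by (rule Max_ge[OF finA])
  qed
  have c1: "c \<le> 1"
    using c_cases
  proof (elim disjE exE conjE)
    fix X assume "X \<subseteq> V" "s \<in> X" "t \<notin> X" "c = sum M X - separated B X"
    then show ?thesis using insert.prems(3)[of X] sep[of X] by simp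
  qed simp
  have c4: "c \<le> separated B Y - sum M Y" if Y: "Y \<subseteq> V" "s \<notin> Y" "t \<in> Y" for Y
    using c_cases
  proof (elim disjE exE conjE)
    assume "c = -1"
    then show ?thesis using insert.prems(3)[OF Y(1)] sep[of Y] Y by simp
  next
    fix X assume X: "X \<subseteq> V" "s \<in> X" "t \<notin> X" "c = sum M X - separated B X"
    have "finite X" "finite Y" using finite_subset[OF _ assms(1)] X(1) Y(1) by blast+
    \<comment> \<open>Uncrossing: neither \<open>X \<inter> Y\<close> nor
      \<open>X \<union> Y\<close> separates \<open>s\<close> from \<open>t\<close>, so for them the
      cut condition does not involve \<open>b\<close>.\<close>
    then have "sum M X + sum M Y = sum M (X \<inter> Y) + sum M (X \<union> Y)"
      using sum.union_inter[of X Y M] by simp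
    moreover have "sum M (X \<inter> Y) \<le> separated B (X \<inter> Y)"
      using insert.prems(3)[of "X \<inter> Y"] sep[of "X \<inter> Y"] X(1-3) Y by (simp add: le_infI1)
    moreover have "sum M (X \<union> Y) \<le> separated B (X \<union> Y)"
      using insert.prems(3)[of "X \<union> Y"] sep[of "X \<union> Y"] X(1-3) Y by simp
    ultimately show ?thesis using separated_submodular[of B X Y] X(4) by linarith
  qed
  define M' where "M' v = M v - (of_bool (s = v) - of_bool (t = v)) * c" for v
  have M': "sum M' X = sum M X - (of_bool (s \<in> X) - of_bool (t \<in> X)) * c" if "X \<subseteq> V" for X
  proof -
    have "finite X" using that assms(1) by (rule finite_subset)
    then have "(\<Sum>v\<in>X. of_bool (u = v)) = (of_bool (u \<in> X) :: int)" for u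
      by (simp add: of_bool_def)
    then show ?thesis
      by (simp add: M'_def sum_subtractf sum_distrib_right[symmetric])
  qed
  have "\<exists>\<phi>. (\<forall>b\<in>B. \<phi> b \<in> {-1, 0, 1}) \<and> (\<forall>v\<in>V. outflow B \<phi> v = M' v)"
  proof (rule insert.IH)
    show "B \<subseteq> V \<times> V" using insert.prems by auto
    show "sum M' V = 0" using M'[of V] insert.prems st by simp
    fix X assume X: "X \<subseteq> V"
    show "sum M' X \<le> separated B X"
      using M'[OF X] c3[OF X] c4[OF X] insert.prems(3)[OF X] sep[of X]
      by (cases "s \<in> X"; cases "t \<in> X") auto
  qed
  then obtain \<phi> where \<phi>: "\<forall>b\<in>B. \<phi> b \<in> {-1, 0, 1}" "\<forall>v\<in>V. outflow B \<phi> v = M' v" by blast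
  have "outflow (insert b B) (\<phi>(b := c)) v = M v" if "v \<in> V" for v
  proof -
    have "outflow B (\<phi>(b := c)) v = outflow B \<phi> v"
      using insert.hyps by (intro outflow_cong) auto
    then show ?thesis
      using \<phi>(2) that b outflow_insert[OF insert.hyps, of "\<phi>(b := c)" v] by (simp add: M'_def)
  qed
  moreover have "c \<in> {-1, 0, 1}" using c1 c2 by auto
  then have "\<forall>b'\<in>insert b B. (\<phi>(b := c)) b' \<in> {-1, 0, 1}" using \<phi>(1) by simp
  ultimately show ?case by blast
qed

section \<open>Orientations with outflow at most 1 in absolute value\<close>

definition valency :: "('a \<times> 'a) set \<Rightarrow> 'a \<Rightarrow> nat" where
  "valency Q v = card {b \<in> Q. fst b = v \<or> snd b = v}"

lemma valency_remove:
  assumes "finite Q" "b \<in> Q"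
  shows "valency Q v = valency (Q - {b}) v + of_bool (fst b = v \<or> snd b = v)"
proof -
  have "{b' \<in> Q. fst b' = v \<or> snd b' = v} =
    (if fst b = v \<or> snd b = v then insert b {b' \<in> Q - {b}. fst b' = v \<or> snd b' = v}
     else {b' \<in> Q - {b}. fst b' = v \<or> snd b' = v})"
    using assms(2) by auto
  then show ?thesis using assms(1) by (auto simp: valency_def)
qed

lemma outflow_remove:
  assumes "finite Q" "b \<in> Q"
  shows "outflow Q (\<phi>(b := c)) v =
    outflow (Q - {b}) \<phi> v + (of_bool (fst b = v) - of_bool (snd b = v)) * c"
proof -
  have "outflow Q (\<phi>(b := c)) v =
      outflow (Q - {b}) (\<phi>(b := c)) v + (of_bool (fst b = v) - of_bool (snd b = v)) * c"
    using outflow_insert[of "Q - {b}" b "\<phi>(b := c)" v] assms by (simp add: insert_absorb)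
  also have "outflow (Q - {b}) (\<phi>(b := c)) v = outflow (Q - {b}) \<phi> v"
    by (rule outflow_cong) auto
  finally show ?thesis .
qed

text \<open>Modulo 2 every edge at \<open>v\<close> contributes 1; a loop would contribute 0 to the
  outflow but 1 to the valency.\<close>

lemma even_outflow_iff:
  assumes "finite Q" "\<forall>b\<in>Q. fst b \<noteq> snd b" "\<forall>b\<in>Q. odd (\<psi> b :: int)"
  shows "even (outflow Q \<psi> v) \<longleftrightarrow> even (valency Q v)"
  using assms
proof (induction Q rule: finite_induct)
  case empty
  then show ?case by (simp add: outflow_def valency_def)
next
  case (insert b Q)
  then show ?case
    using valency_remove[of "insert b Q" b v] outflow_insert[of Q b \<psi> v] by auto
qed

lemma sum_outflow:
  assumes "finite Q" "finite V" "Q \<subseteq> V \<times> V"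
  shows "(\<Sum>v\<in>V. outflow Q \<psi> v) = 0"
proof -
  have "(\<Sum>v\<in>V. \<Sum>b\<in>Q. of_bool (f b = v) * \<psi> b) = (\<Sum>b\<in>Q. \<psi> b)" if "f ` Q \<subseteq> V" for f
  proof -
    have "(\<Sum>v\<in>V. \<Sum>b\<in>Q. of_bool (f b = v) * \<psi> b) = (\<Sum>b\<in>Q. \<Sum>v\<in>V. of_bool (f b = v) * \<psi> b)"
      by (rule sum.swap)
    also have "\<dots> = (\<Sum>b\<in>Q. \<psi> b)"
      using that assms(2) by (intro sum.cong) (auto simp: of_bool_def if_distrib if_distribR cong: if_cong)
    finally show ?thesis .
  qed
  moreover have "fst ` Q \<subseteq> V" "snd ` Q \<subseteq> V" using assms(3) by auto
  ultimately show ?thesis by (simp add: outflow_def sum_subtractf)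
qed

definition paired :: "('a \<Rightarrow> nat) \<Rightarrow> ('a \<Rightarrow> 'a) \<Rightarrow> 'a set \<Rightarrow> bool" where
  "paired d mate U \<longleftrightarrow>
    (\<forall>u\<in>U. odd (d u) \<and> mate u \<in> U \<and> mate u \<noteq> u \<and> mate (mate u) = u)"

text \<open>In each pair one combination of the two values is forbidden.\<close>

definition avoiding :: "('a \<Rightarrow> 'b) \<Rightarrow> ('a \<Rightarrow> 'a) \<Rightarrow> 'a set \<Rightarrow> ('a \<Rightarrow> 'b) \<Rightarrow> bool" where
  "avoiding bad mate U f \<longleftrightarrow> (\<forall>u\<in>U. f u \<noteq> bad u \<or> f (mate u) \<noteq> bad (mate u))"

text \<open>\<open>\<psi>\<close> is an orientation: 1 keeps the reference direction of an edge, -1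
  reverses it.\<close>

definition near_balanced :: "('a \<times> 'a) set \<Rightarrow> ('a \<times> 'a \<Rightarrow> int) \<Rightarrow> bool" where
  "near_balanced Q \<psi> \<longleftrightarrow> (\<forall>b\<in>Q. \<psi> b \<in> {-1, 1}) \<and> (\<forall>v. \<bar>outflow Q \<psi> v\<bar> \<le> 1)"

lemma near_balanced_outflow:
  assumes "near_balanced Q \<psi>" "finite Q" "\<forall>b\<in>Q. fst b \<noteq> snd b"
  shows "even (valency Q v) \<Longrightarrow> outflow Q \<psi> v = 0"
    and "odd (valency Q v) \<Longrightarrow> outflow Q \<psi> v \<in> {-1, 1}"
proof -
  have "\<forall>b\<in>Q. odd (\<psi> b)" "\<bar>outflow Q \<psi> v\<bar> \<le> 1"
    using assms(1) by (auto simp: near_balanced_def)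
  then have *: "even (outflow Q \<psi> v) \<longleftrightarrow> even (valency Q v)" "\<bar>outflow Q \<psi> v\<bar> \<le> 1"
    using even_outflow_iff[OF assms(2,3)] by simp_all
  have "outflow Q \<psi> v \<in> {-1, 0, 1}" using *(2) by auto
  then show "even (valency Q v) \<Longrightarrow> outflow Q \<psi> v = 0"
    and "odd (valency Q v) \<Longrightarrow> outflow Q \<psi> v \<in> {-1, 1}" using *(1) by auto
qed

lemma near_balanced_extend:
  assumes "near_balanced (Q - {b}) \<psi>" "finite Q" "b \<in> Q" "fst b \<noteq> snd b" "c \<in> {-1, 1}"
    and "\<bar>outflow (Q - {b}) \<psi> (fst b) + c\<bar> \<le> 1" "\<bar>outflow (Q - {b}) \<psi> (snd b) - c\<bar> \<le> 1"
  shows "near_balanced Q (\<psi>(b := c))"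
  using assms by (auto simp: near_balanced_def outflow_remove of_bool_def)

text \<open>Walk along unused edges, entering and leaving a vertex alternately. A walk that gets stuck with
  the forbidden value at a vertex is continued from its mate, started in the harmless direction. The
  first part of the statement is such a walk that has to continue at \<open>x\<close>.\<close>

lemma exists_near_balanced:
  fixes Q :: "('a \<times> 'a) set"
  assumes "finite Q" "\<forall>b\<in>Q. fst b \<noteq> snd b"
  shows "(\<forall>U x s. paired (valency Q) mate U \<and> odd (valency Q x) \<and> x \<notin> U \<and> s \<in> {-1, 1} \<longrightarrow>
      (\<exists>\<psi>. near_balanced Q \<psi> \<and> avoiding bad mate U (outflow Q \<psi>) \<and> outflow Q \<psi> x = s)) \<and>
    (\<forall>U. paired (valency Q) mate U \<longrightarrow>
      (\<exists>\<psi>. near_balanced Q \<psi> \<and> avoiding bad mate U (outflow Q \<psi>)))"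
  using assms
proof (induction "card Q" arbitrary: Q rule: less_induct)
  case less
  note fin = \<open>finite Q\<close> and loopfree = \<open>\<forall>b\<in>Q. fst b \<noteq> snd b\<close>
  have IH_A: "\<exists>\<psi>. near_balanced (Q - {b}) \<psi> \<and> avoiding bad mate U (outflow (Q - {b}) \<psi>) \<and>
      outflow (Q - {b}) \<psi> x = s"
    if "b \<in> Q" "paired (valency (Q - {b})) mate U" "odd (valency (Q - {b}) x)" "x \<notin> U" "s \<in> {-1, 1}"
    for b U x s
    using less.hyps[of "Q - {b}"] fin loopfree that
    by (metis Diff_iff card_Diff1_less finite_Diff)
  have IH_B: "\<exists>\<psi>. near_balanced (Q - {b}) \<psi> \<and> avoiding bad mate U (outflow (Q - {b}) \<psi>)"
    if "b \<in> Q" "paired (valency (Q - {b})) mate U" for b U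
    using less.hyps[of "Q - {b}"] fin loopfree that
    by (metis Diff_iff card_Diff1_less finite_Diff)
  have demand: "\<exists>\<psi>. near_balanced Q \<psi> \<and> avoiding bad mate U (outflow Q \<psi>) \<and> outflow Q \<psi> x = s"
    if U: "paired (valency Q) mate U" and x: "odd (valency Q x)" "x \<notin> U" and s: "s \<in> {-1, 1}"
    for U x s
  proof -
    have "{b \<in> Q. fst b = x \<or> snd b = x} \<noteq> {}"
      using x(1) unfolding valency_def by (metis card.empty even_zero)
    then obtain b where b: "b \<in> Q" "fst b = x \<or> snd b = x" by blast
    \<comment> \<open>The walk goes along \<open>b\<close> from \<open>x\<close> to
      \<open>z\<close>; with the sign \<open>c\<close> the edge contributes \<open>s\<close> to the
      outflow at \<open>x\<close> and \<open>- s\<close> at \<open>z\<close>.\<close>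
    define z where "z = (if fst b = x then snd b else fst b)"
    define c where "c = (if fst b = x then s else - s)"
    let ?Q = "Q - {b}"
    have zx: "z \<noteq> x" using b loopfree by (auto simp: z_def)
    have c: "c \<in> {-1, 1}" using s by (auto simp: c_def)
    have val: "valency Q v = valency ?Q v + of_bool (v = x \<or> v = z)" for v
      using valency_remove[OF fin b(1), of v] b(2) by (auto simp: z_def)
    have out: "outflow Q (\<psi>(b := c)) v = outflow ?Q \<psi> v + (of_bool (v = x) - of_bool (v = z)) * s"
      for \<psi> v
      using outflow_remove[OF fin b(1), of \<psi> c v] b(2) loopfree b(1) by (auto simp: z_def c_def)
    have even0: "outflow ?Q \<psi> v = 0" if "near_balanced ?Q \<psi>" "even (valency ?Q v)" for \<psi> v
      using near_balanced_outflow(1)[OF that(1) _ _ that(2)] fin loopfree by auto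
    have nb: "near_balanced Q (\<psi>(b := c))"
      if "near_balanced ?Q \<psi>" "outflow ?Q \<psi> x = 0" "\<bar>outflow ?Q \<psi> z - s\<bar> \<le> 1" for \<psi>
      using that out[of \<psi>] c s unfolding near_balanced_def
      by (auto simp: of_bool_def)
    have evx: "even (valency ?Q x)" using val[of x] x by simp
    show ?thesis
    proof (cases "z \<in> U")
      case True
      \<comment> \<open>Without \<open>b\<close> the vertex \<open>z\<close> has even valency and
        outflow 0, so it ends with \<open>- s\<close>. Its pair is harmless unless this is the bad
        value at \<open>z\<close>.\<close>
      let ?U = "U - {z, mate z}"
      have z: "odd (valency Q z)" "mate z \<in> U" "mate z \<noteq> z" "mate (mate z) = z" "mate z \<noteq> x"
        using U True x by (auto simp: paired_def)
      have evz: "even (valency ?Q z)" using val[of z] z by simp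
      have U': "paired (valency ?Q) mate ?U"
        using U True x(2) val unfolding paired_def by (auto; metis)
      have lift: ?thesis
        if \<psi>: "near_balanced ?Q \<psi>" "avoiding bad mate ?U (outflow ?Q \<psi>)"
          and *: "- s \<noteq> bad z \<or> outflow ?Q \<psi> (mate z) \<noteq> bad (mate z)" for \<psi>
      proof -
        have o0: "outflow ?Q \<psi> x = 0" "outflow ?Q \<psi> z = 0"
          using even0[OF \<psi>(1)] evx evz by auto
        have oz: "outflow Q (\<psi>(b := c)) z = - s"
          "outflow Q (\<psi>(b := c)) (mate z) = outflow ?Q \<psi> (mate z)"
          using out[of \<psi>] o0 zx z by auto
        have "outflow Q (\<psi>(b := c)) u \<noteq> bad u \<or> outflow Q (\<psi>(b := c)) (mate u) \<noteq> bad (mate u)"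
          if "u \<in> U" for u
        proof (cases "u \<in> {z, mate z}")
          case True
          then show ?thesis using * oz z by auto
        next
          case False
          then have "u \<in> ?U" "mate u \<in> ?U" using that U' by (auto simp: paired_def)
          then show ?thesis using \<psi>(2) out[of \<psi>] x(2) by (auto simp: avoiding_def)
        qed
        moreover have "outflow Q (\<psi>(b := c)) x = s" using out[of \<psi>] o0 zx by simp
        moreover have "near_balanced Q (\<psi>(b := c))" using nb[OF \<psi>(1)] o0 s by auto
        ultimately show ?thesis unfolding avoiding_def by blast
      qed
      show ?thesis
      proof (cases "- s = bad z")
        case False
        then show ?thesis using IH_B[OF b(1) U'] lift by blast
      next
        case True
        \<comment> \<open>The pair is rescued at its other end: a sign that is not bad at
          \<open>mate z\<close> is demanded there.\<close>
        define s' :: int where "s' = (if bad (mate z) = 1 then -1 else 1)"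
        have s': "s' \<in> {-1, 1}" "s' \<noteq> bad (mate z)" by (auto simp: s'_def)
        have "odd (valency ?Q (mate z))"
          using U z val[of "mate z"] by (auto simp: paired_def)
        then obtain \<psi> where "near_balanced ?Q \<psi>" "avoiding bad mate ?U (outflow ?Q \<psi>)"
          "outflow ?Q \<psi> (mate z) = s'"
          using IH_A[OF b(1) U', of "mate z" s'] s' by blast
        then show ?thesis using lift s'(2) by blast
      qed
    next
      case False
      have U': "paired (valency ?Q) mate U"
        using U False x(2) val unfolding paired_def by (auto; metis)
      have lift: ?thesis
        if \<psi>: "near_balanced ?Q \<psi>" "avoiding bad mate U (outflow ?Q \<psi>)"
          and *: "\<bar>outflow ?Q \<psi> z - s\<bar> \<le> 1" for \<psi>
      proof -
        have o0: "outflow ?Q \<psi> x = 0" using even0[OF \<psi>(1)] evx by auto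
        have "outflow Q (\<psi>(b := c)) u = outflow ?Q \<psi> u" if "u \<in> U" for u
          using that out[of \<psi> u] False x(2) by auto
        then have "avoiding bad mate U (outflow Q (\<psi>(b := c)))"
          using \<psi>(2) U by (simp add: avoiding_def paired_def)
        then show ?thesis using nb[OF \<psi>(1) o0 *] out[of \<psi> x] o0 zx by auto
      qed
      show ?thesis
      proof (cases "even (valency ?Q z)")
        case True
        then show ?thesis using IH_B[OF b(1) U'] lift even0[OF _ True] s by fastforce
      next
        case odd: False
        \<comment> \<open>Outflow \<open>s\<close> is demanded at \<open>z\<close> without
          \<open>b\<close>, so that \<open>b\<close> cancels it.\<close>
        then show ?thesis using IH_A[OF b(1) U' _ False s] lift by fastforce
      qed
    qed
  qed
  have free: "\<exists>\<psi>. near_balanced Q \<psi> \<and> avoiding bad mate U (outflow Q \<psi>)"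
    if U: "paired (valency Q) mate U" for U
  proof (cases "U = {}")
    case False
    then obtain u where u: "u \<in> U" by blast
    let ?U = "U - {u, mate u}"
    define s :: int where "s = (if bad u = 1 then -1 else 1)"
    have s: "s \<in> {-1, 1}" "s \<noteq> bad u" by (auto simp: s_def)
    have oddu: "odd (valency Q u)" using U u by (simp add: paired_def)
    have U': "paired (valency Q) mate ?U" using U u unfolding paired_def by (auto; metis)
    obtain \<psi> where \<psi>: "near_balanced Q \<psi>" "avoiding bad mate ?U (outflow Q \<psi>)" "outflow Q \<psi> u = s"
      using demand[OF U', of u s] s oddu by blast
    have "outflow Q \<psi> u' \<noteq> bad u' \<or> outflow Q \<psi> (mate u') \<noteq> bad (mate u')" if "u' \<in> U" for u'
    proof (cases "u' = u \<or> u' = mate u")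
      case True
      moreover have "mate (mate u) = u" using U u by (simp add: paired_def)
      ultimately show ?thesis using \<psi>(3) s(2) by metis
    next
      case False
      then show ?thesis using \<psi>(2) that by (simp add: avoiding_def)
    qed
    then have "avoiding bad mate U (outflow Q \<psi>)" unfolding avoiding_def by blast
    then show ?thesis using \<psi>(1) by blast
  next
    case U0: True
    show ?thesis
    proof (cases "\<exists>x. odd (valency Q x)")
      case True
      then show ?thesis using demand[of "{}" _ 1] U0 by (auto simp: paired_def avoiding_def)
    next
      case False
      show ?thesis
      proof (cases "Q = {}")
        case True
        then show ?thesis using U0 by (auto simp: near_balanced_def avoiding_def outflow_def)
      next
        case nonempty: False
        \<comment> \<open>All valencies are even. Deleting \<open>b\<close> makes its ends the only
          odd vertices; as the total outflow is 0, outflow -1 at one end forces 1 at the other, and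
          restoring \<open>b\<close> with value 1 balances both.\<close>
        then obtain b where b: "b \<in> Q" by blast
        let ?Q = "Q - {b}"
        have neq: "fst b \<noteq> snd b" using b loopfree by blast
        have val: "odd (valency ?Q v) \<longleftrightarrow> v \<in> {fst b, snd b}" for v
        proof -
          have "even (valency ?Q v + of_bool (fst b = v \<or> snd b = v))"
            using valency_remove[OF fin b, of v] False by metis
          then show ?thesis by (auto simp: of_bool_def split: if_splits)
        qed
        obtain \<psi> where \<psi>: "near_balanced ?Q \<psi>" "outflow ?Q \<psi> (fst b) = -1"
          using IH_A[OF b, of "{}" "fst b" "-1"] val[of "fst b"] by (auto simp: paired_def)
        define V where "V = fst ` Q \<union> snd ` Q"
        have "?Q \<subseteq> V \<times> V" by (force simp: V_def)
        then have "(\<Sum>v\<in>V. outflow ?Q \<psi> v) = 0"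
          using sum_outflow[of ?Q V] fin by (simp add: V_def)
        moreover have "(\<Sum>v\<in>V. outflow ?Q \<psi> v) = (\<Sum>v\<in>{fst b, snd b}. outflow ?Q \<psi> v)"
        proof (rule sum.mono_neutral_right)
          show "finite V" "{fst b, snd b} \<subseteq> V" using fin b by (auto simp: V_def)
          show "\<forall>v\<in>V - {fst b, snd b}. outflow ?Q \<psi> v = 0"
            using near_balanced_outflow(1)[OF \<psi>(1)] val fin loopfree by blast
        qed
        ultimately have "outflow ?Q \<psi> (snd b) = 1" using \<psi>(2) neq by simp
        then have "near_balanced Q (\<psi>(b := 1))"
          using near_balanced_extend[OF \<psi>(1) fin b neq] \<psi>(2) by simp
        then show ?thesis using U0 by (auto simp: avoiding_def)
      qed
    qed
  qed
  show ?case
  proof (intro conjI allI impI)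
    fix U x s assume "paired (valency Q) mate U \<and> odd (valency Q x) \<and> x \<notin> U \<and> s \<in> {-1, 1 :: int}"
    then show "\<exists>\<psi>. near_balanced Q \<psi> \<and> avoiding bad mate U (outflow Q \<psi>) \<and> outflow Q \<psi> x = s"
      by (elim conjE) (rule demand)
  next
    fix U assume "paired (valency Q) mate U"
    then show "\<exists>\<psi>. near_balanced Q \<psi> \<and> avoiding bad mate U (outflow Q \<psi>)" by (rule free)
  qed
qed

section \<open>Cuts\<close>

text \<open>With graphs given by neighbourhood functions, a side of a cut and the graph left after a
  deletion are again instances. By symmetry \<open>N v\<close> is empty outside
  \<open>V\<close>.\<close>

locale nbhd_graph =
  fixes V :: "'a set" and N :: "'a \<Rightarrow> 'a set"
  assumes finite_V: "finite V"
    and nbhd_subset: "N v \<subseteq> V"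
    and irrefl: "v \<notin> N v"
    and sym: "x \<in> N v \<Longrightarrow> v \<in> N x"
begin

lemma finite_nbhd [simp]: "finite (N v)"
  using finite_subset[OF nbhd_subset finite_V] .

lemma nbhd_in: "x \<in> N v \<Longrightarrow> x \<in> V"
  using nbhd_subset by blast

end

definition same :: "('a \<Rightarrow> 'a set) \<Rightarrow> ('a \<Rightarrow> bool) \<Rightarrow> 'a \<Rightarrow> 'a set" where
  "same N side v = {x \<in> N v. side x = side v}"

definition other :: "('a \<Rightarrow> 'a set) \<Rightarrow> ('a \<Rightarrow> bool) \<Rightarrow> 'a \<Rightarrow> 'a set" where
  "other N side v = {x \<in> N v. side x \<noteq> side v}"

text \<open>No flip of a vertex set increases the cut, that is, \<open>side\<close> is a maximum cut.\<close>

definition balanced :: "'a set \<Rightarrow> ('a \<Rightarrow> 'a set) \<Rightarrow> ('a \<Rightarrow> bool) \<Rightarrow> bool" where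
  "balanced V N side \<longleftrightarrow> (\<forall>X\<subseteq>V. (\<Sum>v\<in>X. card (same N side v - X)) \<le> (\<Sum>v\<in>X. card (other N side v - X)))"

definition paid :: "('a \<Rightarrow> 'a \<Rightarrow> bool) \<Rightarrow> ('a \<Rightarrow> 'a set) \<Rightarrow> 'a \<Rightarrow> nat" where
  "paid pay H v = card {x \<in> H v. pay v x}"

lemma sum_antisym:
  fixes g :: "'a \<Rightarrow> 'a \<Rightarrow> int"
  assumes "\<And>v x. v \<in> X \<Longrightarrow> x \<in> X \<Longrightarrow> g v x = - g x v"
  shows "(\<Sum>v\<in>X. \<Sum>x\<in>X. g v x) = 0"
proof -
  have "(\<Sum>v\<in>X. \<Sum>x\<in>X. g v x) = (\<Sum>v\<in>X. \<Sum>x\<in>X. - g x v)"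
    by (intro sum.cong refl assms)
  also have "\<dots> = - (\<Sum>v\<in>X. \<Sum>x\<in>X. g v x)"
    by (subst sum.swap) (simp add: sum_negf)
  finally show ?thesis by simp
qed

context nbhd_graph
begin

lemma finite_same [simp]: "finite (same N side v)" and finite_other [simp]: "finite (other N side v)"
  by (simp_all add: same_def other_def)

lemma card_same_other: "card (N v) = card (same N side v) + card (other N side v)"
proof -
  have "N v = same N side v \<union> other N side v" by (auto simp: same_def other_def)
  moreover have "same N side v \<inter> other N side v = {}" by (auto simp: same_def other_def)
  ultimately show ?thesis using card_Un_disjoint[OF finite_same finite_other] by metis
qed

lemma sum_payment:
  "(\<Sum>x\<in>same N side v. 1 - 2 * of_bool (pay v x)) = int (card (same N side v)) - 2 * int (paid pay (same N side) v)"
  by (simp add: sum_subtractf sum_distrib_left[symmetric] paid_def Int_def)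

text \<open>A flow with values in \<open>{-1, 0, 1}\<close> on the cut edges balances the payments exactly; it exists since
  the cut is maximum. The edges with flow 0 are then oriented by \<open>exists_near_balanced\<close>.\<close>

lemma cross_factor:
  assumes bal: "balanced V N side"
    and pay: "\<And>v x. x \<in> same N side v \<Longrightarrow> pay v x \<longleftrightarrow> \<not> pay x v"
    and U: "U \<subseteq> V" "paired (\<lambda>v. card (N v)) mate U"
  shows "\<exists>F. (\<forall>v x. F v x \<longleftrightarrow> F x v) \<and>
    (\<forall>v\<in>V. card (N v) div 2 \<le> card {x \<in> other N side v. F v x} + paid pay (same N side) v \<and>
      card {x \<in> other N side v. F v x} + paid pay (same N side) v \<le> (card (N v) + 1) div 2) \<and>
    avoiding bad mate U (\<lambda>v. card {x \<in> other N side v. F v x} + paid pay (same N side) v)"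
proof -
  define B where "B = {(s, t). s \<in> V \<and> side s \<and> t \<in> other N side s}"
  define sg :: "'a \<Rightarrow> int" where "sg v = (if side v then 1 else -1)" for v
  define m where "m = paid pay (same N side)"
  \<comment> \<open>Cut edges with final value 1 will be chosen, so twice their number at
    \<open>v\<close> is \<open>card (other N side v)\<close> plus \<open>sg v\<close> times the
    outflow. For outflow \<open>M v\<close> this is the degree minus twice the payments of
    \<open>v\<close>.\<close>
  define M where "M v = sg v * (int (card (same N side v)) - 2 * int (m v))" for v
  have BV: "B \<subseteq> V \<times> V" using nbhd_subset by (auto simp: B_def other_def)
  have finB: "finite B" using finite_subset[OF BV] finite_V by simp
  have loopfree: "\<forall>b\<in>B. fst b \<noteq> snd b" using irrefl by (auto simp: B_def other_def)
  have M_sum: "sum M X = (\<Sum>v\<in>X. \<Sum>x\<in>same N side v. sg v * (1 - 2 * of_bool (pay v x)))" for X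
    unfolding M_def m_def by (simp add: sum_distrib_left[symmetric] sum_payment)
  \<comment> \<open>Exactly one end pays for an edge inside \<open>X\<close>, so its two
    contributions cancel.\<close>
  have M_inner: "(\<Sum>v\<in>X. \<Sum>x\<in>same N side v \<inter> X. sg v * (1 - 2 * of_bool (pay v x))) = 0"
    if "X \<subseteq> V" for X
  proof -
    have "finite X" using that finite_V by (rule finite_subset)
    then have "(\<Sum>x\<in>same N side v \<inter> X. sg v * (1 - 2 * of_bool (pay v x))) =
        (\<Sum>x\<in>X. of_bool (x \<in> same N side v) * (sg v * (1 - 2 * of_bool (pay v x))))" for v
      by (intro sum.mono_neutral_cong_left) auto
    moreover have "(\<Sum>v\<in>X. \<Sum>x\<in>X. of_bool (x \<in> same N side v) * (sg v * (1 - 2 * of_bool (pay v x)))) = 0"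
    proof (rule sum_antisym)
      fix v x
      have "x \<in> same N side v \<longleftrightarrow> v \<in> same N side x" using sym by (auto simp: same_def)
      moreover have "sg v = sg x" if "x \<in> same N side v" using that by (simp add: sg_def same_def)
      ultimately show "of_bool (x \<in> same N side v) * (sg v * (1 - 2 * of_bool (pay v x))) =
          - (of_bool (v \<in> same N side x) * (sg x * (1 - 2 * of_bool (pay x v))))"
        using pay[of x v] by (cases "x \<in> same N side v") auto
    qed
    ultimately show ?thesis by simp
  qed
  have sep: "separated B X = int (\<Sum>v\<in>X. card (other N side v - X))" if "X \<subseteq> V" for X
  proof -
    have finX: "finite X" using that finite_V by (rule finite_subset)
    let ?C = "{b \<in> B. (fst b \<in> X) \<noteq> (snd b \<in> X)}"
    have "bij_betw (\<lambda>(v, x). if side v then (v, x) else (x, v)) (SIGMA v:X. other N side v - X) ?C"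
    proof (rule bij_betwI[where g = "\<lambda>(s, t). if s \<in> X then (s, t) else (t, s)"])
      show "(\<lambda>(v, x). if side v then (v, x) else (x, v)) \<in> (SIGMA v:X. other N side v - X) \<rightarrow> ?C"
        using that sym nbhd_in by (auto simp: B_def other_def)
      show "(\<lambda>(s, t). if s \<in> X then (s, t) else (t, s)) \<in> ?C \<rightarrow> (SIGMA v:X. other N side v - X)"
        using sym by (auto simp: B_def other_def)
    qed (auto simp: B_def other_def)
    then have "card ?C = card (SIGMA v:X. other N side v - X)" by (rule bij_betw_same_card[symmetric])
    then have "card ?C = (\<Sum>v\<in>X. card (other N side v - X))" using finX by simp
    moreover have "separated B X = int (card ?C)"
      using finB by (simp add: separated_def Int_def)
    ultimately show ?thesis by simp
  qed
  have "\<exists>\<phi>. (\<forall>b\<in>B. \<phi> b \<in> {-1, 0, 1}) \<and> (\<forall>v\<in>V. outflow B \<phi> v = M v)"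
  proof (rule exists_bounded_flow[OF finite_V finB BV])
    have "same N side v \<inter> V = same N side v" for v using nbhd_subset by (auto simp: same_def)
    then show "sum M V = 0" using M_inner[of V] M_sum[of V] by simp
    fix X assume X: "X \<subseteq> V"
    \<comment> \<open>Only same-side edges leaving \<open>X\<close> remain, each contributing at
      most 1; maximality of the cut compares them with the cut edges leaving
      \<open>X\<close>.\<close>
    have "sum M X = (\<Sum>v\<in>X. \<Sum>x\<in>same N side v - X. sg v * (1 - 2 * of_bool (pay v x)))"
    proof -
      have "(\<Sum>x\<in>same N side v. f x) = (\<Sum>x\<in>same N side v \<inter> X. f x) + (\<Sum>x\<in>same N side v - X. f x)"
        for f :: "'a \<Rightarrow> int" and v
        by (subst sum.union_disjoint[symmetric]) (auto intro: sum.cong)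
      then show ?thesis using M_inner[OF X] M_sum[of X] by (simp add: sum.distrib)
    qed
    also have "\<dots> \<le> (\<Sum>v\<in>X. \<Sum>x\<in>same N side v - X. 1)"
      by (intro sum_mono) (auto simp: sg_def)
    also have "\<dots> = int (\<Sum>v\<in>X. card (same N side v - X))" by simp
    also have "\<dots> \<le> int (\<Sum>v\<in>X. card (other N side v - X))"
      using bal X unfolding balanced_def by (simp only: of_nat_le_iff)
    finally show "sum M X \<le> separated B X" using sep[OF X] by simp
  qed
  then obtain \<phi> where \<phi>: "\<forall>b\<in>B. \<phi> b \<in> {-1, 0, 1}" "\<forall>v\<in>V. outflow B \<phi> v = M v" by blast
  define Q where "Q = {b \<in> B. \<phi> b = 0}"
  have QB: "Q \<subseteq> B" by (auto simp: Q_def)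
  have finQ: "finite Q" using finite_subset[OF QB finB] .
  have lfQ: "\<forall>b\<in>Q. fst b \<noteq> snd b" using loopfree QB by blast
  have out_split: "outflow B \<chi> v = outflow (B - Q) \<chi> v + outflow Q \<chi> v" for \<chi> v
    using QB finB by (simp add: outflow_def sum.subset_diff[OF QB finB])
  have valB: "valency B v = card (other N side v)" if "v \<in> V" for v
  proof -
    have "{b \<in> B. fst b = v \<or> snd b = v} =
        (if side v then (\<lambda>x. (v, x)) ` other N side v else (\<lambda>x. (x, v)) ` other N side v)"
      using that sym nbhd_in by (auto simp: B_def other_def)
    then show ?thesis by (simp add: valency_def card_image inj_on_def)
  qed
  \<comment> \<open>Nonzero flow values are odd, and \<open>M v\<close> has the parity of
    \<open>card (same N side v)\<close>; hence the edges without flow at \<open>v\<close> have the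
    parity of the degree.\<close>
  have parity: "odd (valency Q v) \<longleftrightarrow> odd (card (N v))" if "v \<in> V" for v
  proof -
    have "\<forall>b\<in>B - Q. odd (\<phi> b)" using \<phi>(1) by (force simp: Q_def)
    then have "even (outflow (B - Q) \<phi> v) \<longleftrightarrow> even (valency (B - Q) v)"
      using even_outflow_iff[of "B - Q" \<phi> v] finB loopfree by auto
    moreover have "outflow Q \<phi> v = 0" by (simp add: outflow_def Q_def)
    moreover have "valency B v = valency (B - Q) v + valency Q v"
    proof -
      have "{b \<in> B. fst b = v \<or> snd b = v} =
          {b \<in> B - Q. fst b = v \<or> snd b = v} \<union> {b \<in> Q. fst b = v \<or> snd b = v}" using QB by auto
      then show ?thesis unfolding valency_def
        using finB finQ by (subst card_Un_disjoint[symmetric]) auto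
    qed
    moreover have "even (M v) \<longleftrightarrow> even (card (same N side v))" by (simp add: M_def sg_def)
    ultimately show ?thesis
      using out_split[of \<phi> v] \<phi>(2) valB[OF that] that card_same_other[of v side] by (metis add_0_right even_add)
  qed
  have "paired (valency Q) mate U" using U parity unfolding paired_def by blast
  \<comment> \<open>Bad values are translated into outflows by the equation that is proved as
    \<open>two_r\<close> below.\<close>
  then obtain \<psi> where \<psi>: "near_balanced Q \<psi>"
    "avoiding (\<lambda>v. sg v * (2 * int (bad v) - int (card (N v)))) mate U (outflow Q \<psi>)"
    using exists_near_balanced[OF finQ lfQ] by blast
  define \<chi> where "\<chi> b = (if b \<in> Q then \<psi> b else \<phi> b)" for b
  have \<chi>: "\<chi> b \<in> {-1, 1}" if "b \<in> B" for b
  proof (cases "b \<in> Q")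
    case True
    then show ?thesis using \<psi>(1) unfolding \<chi>_def near_balanced_def by simp
  next
    case False
    then have "\<phi> b \<noteq> 0" using that by (simp add: Q_def)
    then show ?thesis using \<phi>(1) that False by (auto simp: \<chi>_def)
  qed
  have out\<chi>: "outflow B \<chi> v = M v + outflow Q \<psi> v" if "v \<in> V" for v
  proof -
    have "outflow (B - Q) \<chi> v = outflow (B - Q) \<phi> v" "outflow Q \<chi> v = outflow Q \<psi> v"
      "outflow Q \<phi> v = 0"
      by (auto intro: outflow_cong simp: \<chi>_def) (simp add: outflow_def Q_def)
    then show ?thesis using out_split[of \<chi> v] out_split[of \<phi> v] \<phi>(2) that by simp
  qed
  define F where "F v x \<longleftrightarrow> (v, x) \<in> B \<and> \<chi> (v, x) = 1 \<or> (x, v) \<in> B \<and> \<chi> (x, v) = 1" for v x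
  define p where "p v = card {x \<in> other N side v. F v x}" for v
  have two_p: "2 * int (p v) = int (card (other N side v)) + sg v * outflow B \<chi> v" if v: "v \<in> V" for v
  proof -
    define \<omega> where "\<omega> x = (if side v then \<chi> (v, x) else \<chi> (x, v))" for x
    have \<omega>: "\<omega> x \<in> {-1, 1}" "F v x \<longleftrightarrow> \<omega> x = 1" if "x \<in> other N side v" for x
      using that v sym nbhd_in \<chi>[of "(v, x)"] \<chi>[of "(x, v)"]
      by (auto simp: \<omega>_def F_def B_def other_def)
    have sel: "(\<Sum>b\<in>B. of_bool (fst b = v) * \<chi> b) = (if side v then \<Sum>x\<in>other N side v. \<omega> x else 0)"
    proof (cases "side v")
      case True
      have "(\<Sum>b\<in>B. of_bool (fst b = v) * \<chi> b) = (\<Sum>b\<in>(\<lambda>x. (v, x)) ` other N side v. \<chi> b)"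
        using finB True v by (intro sum.mono_neutral_cong_right) (auto simp: B_def)
      also have "\<dots> = (\<Sum>x\<in>other N side v. \<omega> x)"
        using True by (subst sum.reindex) (auto simp: inj_on_def \<omega>_def)
      finally show ?thesis using True by simp
    qed (auto simp: B_def intro!: sum.neutral)
    have sel': "(\<Sum>b\<in>B. of_bool (snd b = v) * \<chi> b) = (if side v then 0 else \<Sum>x\<in>other N side v. \<omega> x)"
    proof (cases "side v")
      case False
      have "(\<Sum>b\<in>B. of_bool (snd b = v) * \<chi> b) = (\<Sum>b\<in>(\<lambda>x. (x, v)) ` other N side v. \<chi> b)"
        using finB False v sym nbhd_in
        by (intro sum.mono_neutral_cong_right) (auto simp: B_def other_def image_iff)
      also have "\<dots> = (\<Sum>x\<in>other N side v. \<omega> x)"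
        using False by (subst sum.reindex) (auto simp: inj_on_def \<omega>_def)
      finally show ?thesis using False by simp
    qed (auto simp: B_def other_def intro!: sum.neutral)
    have "(\<Sum>x\<in>other N side v. \<omega> x) = (\<Sum>x\<in>other N side v. 2 * of_bool (F v x) - 1)"
      using \<omega> by (intro sum.cong) auto
    also have "\<dots> = 2 * int (p v) - int (card (other N side v))"
      by (simp add: sum_subtractf sum_distrib_left[symmetric] p_def Int_def)
    finally show ?thesis using sel sel' by (simp add: outflow_def sg_def split: if_splits)
  qed
  have two_r: "2 * int (p v + m v) = int (card (N v)) + sg v * outflow Q \<psi> v" if v: "v \<in> V" for v
  proof -
    have "sg v * M v = int (card (same N side v)) - 2 * int (m v)" by (simp add: M_def sg_def)
    then show ?thesis
      using two_p[OF v] out\<chi>[OF v] card_same_other[of v side] by (simp add: algebra_simps)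
  qed
  have "card (N v) div 2 \<le> p v + m v \<and> p v + m v \<le> (card (N v) + 1) div 2" if v: "v \<in> V" for v
  proof -
    have "\<bar>sg v * outflow Q \<psi> v\<bar> \<le> 1" using \<psi>(1) by (auto simp: near_balanced_def sg_def)
    then have "int (card (N v)) - 1 \<le> 2 * int (p v + m v)" "2 * int (p v + m v) \<le> int (card (N v)) + 1"
      using two_r[OF v] by auto
    then have "card (N v) \<le> 2 * (p v + m v) + 1" "2 * (p v + m v) \<le> card (N v) + 1" by linarith+
    then show ?thesis by presburger
  qed
  moreover have "avoiding bad mate U (\<lambda>v. p v + m v)"
  proof -
    have "outflow Q \<psi> v = sg v * (2 * int (bad v) - int (card (N v)))" if "v \<in> V" "p v + m v = bad v" for v
      using two_r[OF that(1)] that(2) by (auto simp: sg_def split: if_splits)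
    then show ?thesis using \<psi>(2) U unfolding avoiding_def paired_def by (meson subsetD)
  qed
  moreover have "F v x \<longleftrightarrow> F x v" for v x by (auto simp: F_def)
  ultimately show ?thesis unfolding p_def m_def by blast
qed

end

section \<open>Completing one side\<close>

definition round_up :: "bool \<Rightarrow> int \<Rightarrow> int" where
  "round_up q n = (if even n = q then n else n + 1)"

lemma round_up_minus_double: "round_up q (n - 2 * k) = round_up q n - 2 * k"
  by (simp add: round_up_def)

text \<open>\<open>p v\<close> is the number of chosen cut edges at \<open>v\<close>, and \<open>J\<close> chooses the edges inside the side. The
  vertices of \<open>Z\<close> have a deleted neighbour and must avoid the value 0.\<close>

definition completion ::
    "'a set \<Rightarrow> ('a \<Rightarrow> 'a set) \<Rightarrow> ('a \<Rightarrow> nat) \<Rightarrow> bool \<Rightarrow> 'a set \<Rightarrow> ('a \<Rightarrow> nat) \<Rightarrow> ('a \<Rightarrow> 'a \<Rightarrow> bool) \<Rightarrow> bool" where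
  "completion A H d q Z p J \<longleftrightarrow> (\<forall>v x. J v x \<longleftrightarrow> J x v) \<and>
    (\<forall>v\<in>A. \<forall>x\<in>H v. round_up q (int (p v + card {x \<in> H v. J v x})) \<noteq>
      round_up q (int (p x + card {z \<in> H x. J x z}))) \<and>
    (\<forall>v\<in>Z. round_up q (int (p v + card {x \<in> H v. J v x})) \<noteq> 0)"

text \<open>The order of quantifiers matters: payments, pairs and forbidden combinations are fixed
  first; the edges inside the side are chosen afterwards, for every \<open>p\<close> that the cut
  edges may produce.\<close>

definition payment_plan ::
    "'a set \<Rightarrow> ('a \<Rightarrow> 'a set) \<Rightarrow> ('a \<Rightarrow> nat) \<Rightarrow> bool \<Rightarrow> 'a set \<Rightarrow>
      ('a \<Rightarrow> 'a \<Rightarrow> bool) \<Rightarrow> ('a \<Rightarrow> 'a) \<Rightarrow> ('a \<Rightarrow> nat) \<Rightarrow> 'a set \<Rightarrow> bool" where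
  "payment_plan A H d q Z pay mate bad U \<longleftrightarrow> U \<subseteq> A \<and> paired d mate U \<and>
    (\<forall>v. \<forall>x\<in>H v. pay v x \<longleftrightarrow> \<not> pay x v) \<and>
    (\<forall>p. (\<forall>v\<in>A. d v div 2 \<le> p v + paid pay H v \<and> p v + paid pay H v \<le> (d v + 1) div 2) \<and>
        avoiding bad mate U (\<lambda>v. p v + paid pay H v) \<longrightarrow> (\<exists>J. completion A H d q Z p J))"

definition completable ::
    "'a set \<Rightarrow> ('a \<Rightarrow> 'a set) \<Rightarrow> ('a \<Rightarrow> nat) \<Rightarrow> bool \<Rightarrow> 'a set \<Rightarrow> bool" where
  "completable A H d q Z \<longleftrightarrow> (\<exists>pay mate bad U. payment_plan A H d q Z pay mate bad U)"

text \<open>The errors \<open>e1\<close>, \<open>e2\<close> at the two ends of a paired edge are compensated by choosing that edge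
  (\<open>g\<close>) or not.\<close>

lemma pair_choice:
  "\<exists>b1 b2 :: nat. \<forall>e1\<in>{0, 1}. \<forall>e2\<in>{0, 1}. e1 \<noteq> b1 \<or> e2 \<noteq> b2 \<longrightarrow>
    (\<exists>g. round_up q (a1 - 1 + int e1 + of_bool g) = round_up q a1 \<and>
      round_up q (a2 - 1 + int e2 + of_bool g) = round_up q a2)"
proof (cases "even a1 = even a2")
  case True
  then show ?thesis
    \<comment> \<open>The witness 2 is no possible error, so nothing is forbidden: one
      \<open>g\<close> suits both ends whatever the errors are.\<close>
    by (intro exI[of _ 2]; cases "even a1 = q") (simp_all add: round_up_def ex_bool_eq)
next
  case False
  then show ?thesis
    \<comment> \<open>The end already of the right parity fails only for error 1 with
      \<open>g\<close>, the other end only for error 0 without \<open>g\<close>; so just one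
      combination blocks both choices.\<close>
    by (cases "even a1 = q"; intro exI[of _ "if even a1 = q then 1 else 0"] exI[of _ "if even a1 = q then 0 else 1"];
        simp add: round_up_def ex_bool_eq)
qed

text \<open>Two odd vertices of equal degree that only have each other: here the rounded values
  may depend on the errors.\<close>

lemma twin_choice:
  "\<exists>b1 b2 :: nat. \<forall>e1\<in>{0, 1}. \<forall>e2\<in>{0, 1}. e1 \<noteq> b1 \<or> e2 \<noteq> b2 \<longrightarrow>
    (\<exists>g. round_up q (a - 1 + int e1 + of_bool g) \<noteq> round_up q (a + int e2 + of_bool g))"
  \<comment> \<open>The forbidden combination makes the two arguments equal. Otherwise they differ
    by 1 or 2, and the shift by \<open>g\<close> can put a rounding step between them.\<close>
  by (rule exI[of _ 1], rule exI[of _ 0]) (simp add: round_up_def ex_bool_eq)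

section \<open>Values along a ranking\<close>

definition lower :: "('a \<Rightarrow> 'a set) \<Rightarrow> ('a \<Rightarrow> nat) \<Rightarrow> 'a \<Rightarrow> 'a set" where
  "lower H r v = {x \<in> H v. r x < r v}"

definition ties :: "('a \<Rightarrow> 'a set) \<Rightarrow> ('a \<Rightarrow> nat) \<Rightarrow> 'a \<Rightarrow> 'a set" where
  "ties H r v = {x \<in> H v. r x = r v}"

text \<open>A vertex owns its edges to vertices of lower rank, each of which changes its value by one in
  either direction. Two odd neighbours of equal rank form a pair: their common edge moves the value of
  one of them, the one with \<open>hi\<close>, from \<open>d / 2\<close> up to the next integer and that of the other down.\<close>

definition attainable :: "('a \<Rightarrow> 'a set) \<Rightarrow> ('a \<Rightarrow> nat) \<Rightarrow> ('a \<Rightarrow> nat) \<Rightarrow> ('a \<Rightarrow> bool) \<Rightarrow> 'a \<Rightarrow> int set" where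
  "attainable H d r hi v = (\<lambda>j. int (d v div 2) + of_bool (hi v) + int (card (lower H r v)) - 2 * int j) ` {..card (lower H r v)}"

text \<open>With \<open>k\<close> lower neighbours there are \<open>k + 1\<close> attainable values
  in steps of 2. They stay distinct after rounding, so one avoids the at most \<open>k\<close>
  rounded values fixed at lower ranks.\<close>

lemma (in nbhd_graph) greedy_values:
  "\<exists>y. \<forall>v\<in>V. y v \<in> attainable N d r hi v \<and>
    (\<forall>x\<in>lower N r v. round_up q (y x) \<noteq> round_up q (y v))"
proof -
  have "\<exists>y. \<forall>v\<in>V. r v < n \<longrightarrow> y v \<in> attainable N d r hi v \<and>
    (\<forall>x\<in>lower N r v. round_up q (y x) \<noteq> round_up q (y v))" for n
  proof (induction n)
    case (Suc n)
    then obtain y where y: "\<forall>v\<in>V. r v < n \<longrightarrow> y v \<in> attainable N d r hi v \<and>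
      (\<forall>x\<in>lower N r v. round_up q (y x) \<noteq> round_up q (y v))" by blast
    have "\<exists>c. c \<in> attainable N d r hi v \<and> (\<forall>x\<in>lower N r v. round_up q (y x) \<noteq> round_up q c)" for v
    proof -
      let ?k = "card (lower N r v)"
      define b where "b = round_up q (int (d v div 2) + of_bool (hi v) + int ?k)"
      have fin: "finite (lower N r v)" by (simp add: lower_def)
      have "round_up q ` attainable N d r hi v = (\<lambda>j. b - 2 * int j) ` {..?k}"
        unfolding attainable_def image_image round_up_minus_double b_def ..
      then have "card (round_up q ` attainable N d r hi v) = ?k + 1"
        by (simp add: card_image inj_on_def)
      moreover have "card ((\<lambda>x. round_up q (y x)) ` lower N r v) \<le> ?k"
        using fin by (rule card_image_le)
      ultimately have "card ((\<lambda>x. round_up q (y x)) ` lower N r v) < card (round_up q ` attainable N d r hi v)"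
        by linarith
      then obtain z where z: "z \<in> round_up q ` attainable N d r hi v" "z \<notin> (\<lambda>x. round_up q (y x)) ` lower N r v"
        using card_mono[OF finite_imageI[OF fin]] by (meson not_less subsetI)
      then obtain c where "c \<in> attainable N d r hi v" "z = round_up q c" by blast
      then show ?thesis using z(2) by (intro exI[of _ c]) force
    qed
    then obtain c where c: "\<And>v. c v \<in> attainable N d r hi v"
      "\<And>v x. x \<in> lower N r v \<Longrightarrow> round_up q (y x) \<noteq> round_up q (c v)" by metis
    define y' where "y' v = (if r v < n then y v else c v)" for v
    have "y' v \<in> attainable N d r hi v \<and> (\<forall>x\<in>lower N r v. round_up q (y' x) \<noteq> round_up q (y' v))"
      if "v \<in> V" "r v < Suc n" for v
    proof (cases "r v < n")
      case True
      then have "y' x = y x" if "x \<in> lower N r v" for x using that by (simp add: y'_def lower_def)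
      then show ?thesis using y \<open>v \<in> V\<close> True by (simp add: y'_def)
    next
      case False
      then have "y' x = y x" if "x \<in> lower N r v" for x
        using that \<open>r v < Suc n\<close> by (simp add: y'_def lower_def)
      then show ?thesis using c(1)[of v] c(2)[of _ v] False by (simp add: y'_def)
    qed
    then show ?case by blast
  qed simp
  moreover obtain n where "\<forall>v\<in>V. r v < n"
    using finite_nat_set_iff_bounded[of "r ` V"] finite_V by auto
  ultimately show ?thesis by metis
qed

lemma card_Un_disjoint_three:
  assumes "finite A" "finite B" "finite C" "A \<inter> B = {}" "(A \<union> B) \<inter> C = {}"
  shows "card (A \<union> B \<union> C) = card A + card B + card C"
  using assms by (simp add: card_Un_disjoint)

text \<open>\<open>y v\<close> prescribes how many edges to lower vertices \<open>v\<close> pays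
  for. Such an edge is chosen exactly when its lower end pays: payment and choice cancel there,
  while the upper end moves by one in either direction. Errors are absorbed at untied odd vertices
  by \<open>pinned\<close> and at tied ones by the common edge.\<close>

lemma (in nbhd_graph) rank_completable:
  fixes r :: "'a \<Rightarrow> nat" and y :: "'a \<Rightarrow> int"
  assumes ties_unique: "\<And>v x z. x \<in> ties N r v \<Longrightarrow> z \<in> ties N r v \<Longrightarrow> x = z"
    and ties_odd: "\<And>v x. x \<in> ties N r v \<Longrightarrow> odd (d v)"
    and hi: "\<And>v x. x \<in> ties N r v \<Longrightarrow> hi x \<longleftrightarrow> \<not> hi v"
    and not_hi: "\<And>v. ties N r v = {} \<Longrightarrow> \<not> hi v"
    and y: "\<And>v. v \<in> V \<Longrightarrow> y v \<in> attainable N d r hi v"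
    and proper: "\<And>v x. x \<in> lower N r v \<Longrightarrow> round_up q (y x) \<noteq> round_up q (y v)"
    and pinned: "\<And>v. N v \<noteq> {} \<Longrightarrow> ties N r v = {} \<Longrightarrow> odd (d v) \<Longrightarrow> round_up q (y v) = y v + 1"
    and ties_proper: "\<And>v x. x \<in> ties N r v \<Longrightarrow>
      round_up q (y x) \<noteq> round_up q (y v) \<or> N v = {x} \<and> N x = {v} \<and> d x = d v"
    and Z: "\<And>v. v \<in> Z \<Longrightarrow> v \<in> V \<and> ties N r v = {} \<and> y v \<ge> 1"
  shows "completable V N d q Z"
proof -
  define k where "k v = card (lower N r v)" for v
  have "\<exists>j\<le>k v. y v = int (d v div 2) + of_bool (hi v) + int (k v) - 2 * int j" if "v \<in> V" for v
    using y[OF that] by (auto simp: attainable_def k_def)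
  then obtain j where j: "\<And>v. v \<in> V \<Longrightarrow> j v \<le> k v"
    "\<And>v. v \<in> V \<Longrightarrow> y v = int (d v div 2) + of_bool (hi v) + int (k v) - 2 * int (j v)" by metis
  have "\<exists>J0\<subseteq>lower N r v. card J0 = j v" if "v \<in> V" for v
    using obtain_subset_with_card_n[of "j v" "lower N r v"] j(1)[OF that] by (metis k_def)
  then obtain J0 where J0: "\<And>v. v \<in> V \<Longrightarrow> J0 v \<subseteq> lower N r v" "\<And>v. v \<in> V \<Longrightarrow> card (J0 v) = j v"
    by metis
  define pay where "pay v x \<longleftrightarrow> (if r x < r v then x \<in> J0 v else if r v < r x then v \<notin> J0 x else \<not> hi v)" for v x
  define T where "T = {v \<in> V. ties N r v \<noteq> {}}"
  define mate where "mate v = the_elem (ties N r v)" for v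
  have mate: "ties N r v = {mate v}" if v: "v \<in> T" for v
  proof -
    obtain x where "x \<in> ties N r v" using v unfolding T_def by blast
    then have "ties N r v = {x}" using ties_unique by blast
    then show ?thesis by (simp add: mate_def)
  qed
  have mateD: "mate v \<in> T" "mate v \<in> N v" "r (mate v) = r v" "mate (mate v) = v" "mate v \<noteq> v"
    "v \<in> V" "odd (d v)" "hi (mate v) \<longleftrightarrow> \<not> hi v" if "v \<in> T" for v
  proof -
    have m: "mate v \<in> ties N r v" using mate[OF that] by simp
    then show mN: "mate v \<in> N v" and rm: "r (mate v) = r v" by (auto simp: ties_def)
    have v: "v \<in> ties N r (mate v)" using sym[OF mN] rm by (simp add: ties_def)
    then show mT: "mate v \<in> T" using nbhd_in[OF mN] by (auto simp: T_def)
    show "mate (mate v) = v" using mate[OF mT] v by simp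
    show "mate v \<noteq> v" using mN irrefl by metis
    show "v \<in> V" using that by (simp add: T_def)
    show "odd (d v)" using ties_odd[OF m] .
    show "hi (mate v) \<longleftrightarrow> \<not> hi v" using hi[OF m] .
  qed
  have "\<exists>b1 b2 :: nat. \<forall>e1\<in>{0, 1}. \<forall>e2\<in>{0, 1}. e1 \<noteq> b1 \<or> e2 \<noteq> b2 \<longrightarrow>
    (\<exists>g. (let c1 = round_up q (y v - 1 + int e1 + of_bool g);
              c2 = round_up q (y (mate v) - 1 + int e2 + of_bool g)
          in c1 \<noteq> c2 \<and> (c1 = round_up q (y v) \<and> c2 = round_up q (y (mate v)) \<or>
            N v = {mate v} \<and> N (mate v) = {v})))"
    if v: "v \<in> T" "\<not> hi v" for v
  proof (cases "round_up q (y (mate v)) \<noteq> round_up q (y v)")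
    case True
    then show ?thesis
      using pair_choice[of q "y v" "y (mate v)"] unfolding Let_def by metis
  next
    case False
    have m: "mate v \<in> ties N r v" "v \<in> ties N r (mate v)"
      using mate[OF v(1)] mate[OF mateD(1)[OF v(1)]] mateD(4)[OF v(1)] by auto
    have *: "N v = {mate v}" "N (mate v) = {v}" "d (mate v) = d v"
      using ties_proper[OF m(1)] False by auto
    have "lower N r v = {}" "lower N r (mate v) = {}"
      using * mateD(3)[OF v(1)] by (auto simp: lower_def)
    then have "k v = 0" "k (mate v) = 0" by (simp_all add: k_def)
    \<comment> \<open>Without lower neighbours each twin has a single attainable value, and the two
      differ only by the summand for \<open>hi\<close>.\<close>
    then have "y (mate v) = y v + 1"
      using j[of v] j[of "mate v"] mateD[OF v(1)] mateD(6)[OF mateD(1)[OF v(1)]] v(2) *(3) by simp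
    then show ?thesis
      using twin_choice[of q "y v"] * unfolding Let_def by simp
  qed
  then obtain b1 b2 where b: "\<And>v e1 e2. v \<in> T \<Longrightarrow> \<not> hi v \<Longrightarrow> e1 \<in> {0, 1} \<Longrightarrow> e2 \<in> {0, 1} \<Longrightarrow>
    e1 \<noteq> b1 v \<or> e2 \<noteq> (b2 v :: nat) \<Longrightarrow>
    \<exists>g. (let c1 = round_up q (y v - 1 + int e1 + of_bool g);
              c2 = round_up q (y (mate v) - 1 + int e2 + of_bool g)
          in c1 \<noteq> c2 \<and> (c1 = round_up q (y v) \<and> c2 = round_up q (y (mate v)) \<or>
            N v = {mate v} \<and> N (mate v) = {v}))"
    by metis
  \<comment> \<open>Forbidden errors become forbidden values of \<open>p v + paid pay N v\<close>.
    Both \<open>b1\<close> and \<open>b2\<close> are indexed by the end without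
    \<open>hi\<close>.\<close>
  define bad where "bad v = d v div 2 + (if hi v then b2 (mate v) else b1 v)" for v
  have paid_eq: "paid pay N v = j v + card {x \<in> N v. r v < r x \<and> v \<notin> J0 x} + of_bool (v \<in> T \<and> \<not> hi v)"
    if v: "v \<in> V" for v
  proof -
    have "{x \<in> N v. pay v x} =
        J0 v \<union> {x \<in> N v. r v < r x \<and> v \<notin> J0 x} \<union> (if \<not> hi v then ties N r v else {})"
      using J0(1)[OF v] by (auto simp: pay_def lower_def ties_def)
    moreover have "card (if \<not> hi v then ties N r v else {}) = of_bool (v \<in> T \<and> \<not> hi v)"
    proof (cases "v \<in> T")
      case True
      then show ?thesis using mate[OF True] by simp
    next
      case False
      then show ?thesis using v by (simp add: T_def)
    qed
    moreover have "finite (J0 v)"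
      using J0(1)[OF v] by (rule finite_subset) (simp add: lower_def)
    moreover have "card (J0 v \<union> {x \<in> N v. r v < r x \<and> v \<notin> J0 x} \<union> (if \<not> hi v then ties N r v else {})) =
        card (J0 v) + card {x \<in> N v. r v < r x \<and> v \<notin> J0 x} + card (if \<not> hi v then ties N r v else {})"
      using J0(1)[OF v] calculation(3)
      by (intro card_Un_disjoint_three) (auto simp: ties_def lower_def)
    ultimately show ?thesis using J0(2)[OF v] by (simp add: paid_def)
  qed
  show ?thesis
    unfolding completable_def payment_plan_def completion_def
  proof (rule exI[of _ pay], rule exI[of _ mate], rule exI[of _ bad], rule exI[of _ T],
      intro conjI allI ballI impI; (elim conjE)?)
    show "T \<subseteq> V" by (auto simp: T_def)
    show "paired d mate T" using mateD by (auto simp: paired_def)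
    fix v x assume x: "x \<in> N v"
    show "pay v x \<longleftrightarrow> \<not> pay x v"
      using hi[of x v] x by (auto simp: pay_def ties_def)
  next
    fix p
    assume p: "\<forall>v\<in>V. d v div 2 \<le> p v + paid pay N v \<and> p v + paid pay N v \<le> (d v + 1) div 2"
      and av: "avoiding bad mate T (\<lambda>v. p v + paid pay N v)"
    \<comment> \<open>The rounding error of the cut edges.\<close>
    define e where "e v = p v + paid pay N v - d v div 2" for v
    have e: "p v + paid pay N v = d v div 2 + e v" "e v \<in> {0, 1}" "even (d v) \<Longrightarrow> e v = 0"
      if "v \<in> V" for v
    proof -
      have *: "d v div 2 \<le> p v + paid pay N v" "p v + paid pay N v \<le> (d v + 1) div 2" using p that by auto
      then show "p v + paid pay N v = d v div 2 + e v" by (simp add: e_def)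
      have "e v \<le> 1" "even (d v) \<Longrightarrow> e v \<le> 0" using * by (auto simp: e_def)
      then show "e v \<in> {0, 1}" "even (d v) \<Longrightarrow> e v = 0" by auto
    qed
    have "\<exists>g. (let c1 = round_up q (y v - 1 + int (e v) + of_bool g);
              c2 = round_up q (y (mate v) - 1 + int (e (mate v)) + of_bool g)
          in c1 \<noteq> c2 \<and> (c1 = round_up q (y v) \<and> c2 = round_up q (y (mate v)) \<or>
            N v = {mate v} \<and> N (mate v) = {v}))" if v: "v \<in> T" "\<not> hi v" for v
    proof (rule b[OF v])
      have V: "v \<in> V" "mate v \<in> V" using mateD(1,6) v by auto
      then show "e v \<in> {0, 1}" "e (mate v) \<in> {0, 1}" using e by auto
      have "p v + paid pay N v \<noteq> bad v \<or> p (mate v) + paid pay N (mate v) \<noteq> bad (mate v)"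
        using av v(1) by (simp add: avoiding_def)
      then show "e v \<noteq> b1 v \<or> e (mate v) \<noteq> b2 v"
        using e(1)[OF V(1)] e(1)[OF V(2)] mateD(4,8)[OF v(1)] v(2) by (auto simp: bad_def)
    qed
    then obtain G where G: "\<And>v. v \<in> T \<Longrightarrow> \<not> hi v \<Longrightarrow>
      (let c1 = round_up q (y v - 1 + int (e v) + of_bool (G v));
              c2 = round_up q (y (mate v) - 1 + int (e (mate v)) + of_bool (G v))
          in c1 \<noteq> c2 \<and> (c1 = round_up q (y v) \<and> c2 = round_up q (y (mate v)) \<or>
            N v = {mate v} \<and> N (mate v) = {v}))" by metis
    define J where "J v x \<longleftrightarrow> x \<in> N v \<and>
      (if r x < r v then x \<notin> J0 v else if r v < r x then v \<notin> J0 x else G (if hi v then x else v))" for v x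
    define w where "w v = int (p v + card {x \<in> N v. J v x})" for v
    define g where "g v = G (if hi v then mate v else v)" for v
    \<comment> \<open>Upward edges drop out, being chosen exactly when \<open>v\<close> pays for
      them. Both ends of a tied edge start from \<open>y v - 1\<close>: the one with
      \<open>hi\<close> because \<open>y v\<close> includes an extra 1, the other because it pays
      for the edge.\<close>
    have w: "w v = y v + int (e v) + of_bool (v \<in> T) * (of_bool (g v) - 1)" if v: "v \<in> V" for v
    proof -
      have "{x \<in> N v. J v x} =
          (lower N r v - J0 v) \<union> {x \<in> N v. r v < r x \<and> v \<notin> J0 x} \<union> (if v \<in> T \<and> g v then ties N r v else {})"
      proof (rule set_eqI)
        fix x
        consider "r x < r v" | "r v < r x" | "r x = r v" by linarith
        then show "x \<in> {x \<in> N v. J v x} \<longleftrightarrow> x \<in> (lower N r v - J0 v) \<union>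
            {x \<in> N v. r v < r x \<and> v \<notin> J0 x} \<union> (if v \<in> T \<and> g v then ties N r v else {})"
        proof cases
          case 3
          have "x \<in> N v \<longleftrightarrow> v \<in> T \<and> x = mate v"
          proof (cases "v \<in> T")
            case True
            then show ?thesis using mate[OF True] 3 by (auto simp: ties_def)
          next
            case False
            then show ?thesis using 3 v by (auto simp: ties_def T_def)
          qed
          then show ?thesis using 3 by (auto simp: J_def lower_def ties_def g_def)
        qed (auto simp: J_def lower_def ties_def)
      qed
      moreover have "card (lower N r v - J0 v) = k v - j v"
      proof -
        have "finite (J0 v)" using J0(1)[OF v] by (rule finite_subset) (simp add: lower_def)
        then show ?thesis using J0[OF v] by (simp add: card_Diff_subset k_def)
      qed
      moreover have "card (if v \<in> T \<and> g v then ties N r v else {}) = of_bool (v \<in> T \<and> g v)"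
        using mate v by simp
      moreover have "card ((lower N r v - J0 v) \<union> {x \<in> N v. r v < r x \<and> v \<notin> J0 x} \<union>
            (if v \<in> T \<and> g v then ties N r v else {})) =
          card (lower N r v - J0 v) + card {x \<in> N v. r v < r x \<and> v \<notin> J0 x} +
            card (if v \<in> T \<and> g v then ties N r v else {})"
        by (intro card_Un_disjoint_three) (auto simp: ties_def lower_def)
      ultimately have "card {x \<in> N v. J v x} =
          (k v - j v) + card {x \<in> N v. r v < r x \<and> v \<notin> J0 x} + of_bool (v \<in> T \<and> g v)"
        by presburger
      moreover have "hi v \<Longrightarrow> v \<in> T" using not_hi v by (auto simp: T_def)
      ultimately show ?thesis
        using j[OF v] paid_eq[OF v] e(1)[OF v] by (auto simp: w_def)
    qed
    have single: "round_up q (w v) = round_up q (y v)" if v: "v \<in> V" "N v \<noteq> {}" "v \<notin> T" for v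
    proof (cases "even (d v)")
      case True
      then show ?thesis using w[OF v(1)] e(3)[OF v(1)] v(3) by simp
    next
      case False
      \<comment> \<open>\<open>y v\<close> has the wrong parity, so errors 0 and 1 lead to the same
        rounded value.\<close>
      have "round_up q (y v) = y v + 1" using pinned v False by (auto simp: T_def)
      then show ?thesis using w[OF v(1)] e(2)[OF v(1)] v(3) by (auto simp: round_up_def split: if_splits)
    qed
    have pairs: "round_up q (w v) \<noteq> round_up q (w (mate v)) \<and>
        (round_up q (w v) = round_up q (y v) \<or> N v = {mate v})" if v: "v \<in> T" for v
    proof -
      have V: "v \<in> V" "mate v \<in> V" using mateD(1,6) v by auto
      have *: "w v = y v - 1 + int (e v) + of_bool (g v)" if "v \<in> T" for v
        using w[of v] mateD(6)[OF that] that by simp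
      have gm: "g (mate v) = g v" using mateD(4,8)[OF v] by (auto simp: g_def)
      show ?thesis
      proof (cases "hi v")
        case False
        then show ?thesis
          using G[OF v] *[OF v] *[OF mateD(1)[OF v]] gm by (auto simp: Let_def g_def)
      next
        case True
        then show ?thesis
          using G[OF mateD(1)[OF v]] *[OF v] *[OF mateD(1)[OF v]] gm mateD(4,8)[OF v]
          by (auto simp: Let_def g_def)
      qed
    qed
    have "round_up q (w v) \<noteq> round_up q (w x)" if x: "x \<in> N v" for v x
    proof (cases "r x = r v")
      case True
      then have "v \<in> T" "x = mate v"
        using x mate[of v] nbhd_in[OF sym[OF x]] by (auto simp: T_def ties_def)
      then show ?thesis using pairs by blast
    next
      case False
      \<comment> \<open>Only twins may deviate from the rounded \<open>y\<close>, and they have no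
        neighbour of another rank.\<close>
      have stable: "round_up q (w u) = round_up q (y u)" if "z \<in> N u" "r z \<noteq> r u" for u z
      proof (cases "u \<in> T")
        case True
        then show ?thesis using pairs[OF True] mateD(3)[OF True] that by auto
      next
        case False
        then show ?thesis using single nbhd_in[OF sym[OF that(1)]] that by auto
      qed
      have "round_up q (y x) \<noteq> round_up q (y v)"
        using proper[of x v] proper[of v x] x sym[OF x] False by (auto simp: lower_def neq_iff)
      then show ?thesis using stable[OF x False] stable[OF sym[OF x]] False by metis
    qed
    moreover have "round_up q (w v) \<noteq> 0" if "v \<in> Z" for v
    proof -
      have "v \<in> V" "v \<notin> T" "y v \<ge> 1" using Z[OF that] by (auto simp: T_def)
      then show ?thesis using w[of v] by (auto simp: round_up_def)
    qed
    moreover have "J v x \<longleftrightarrow> J x v" for v x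
      using sym[of x v] sym[of v x] hi[of x v] by (auto simp: J_def ties_def)
    ultimately show "\<exists>J. (\<forall>v x. J v x \<longleftrightarrow> J x v) \<and>
        (\<forall>v\<in>V. \<forall>x\<in>N v. round_up q (int (p v + card {x \<in> N v. J v x})) \<noteq>
          round_up q (int (p x + card {z \<in> N x. J x z}))) \<and>
        (\<forall>v\<in>Z. round_up q (int (p v + card {x \<in> N v. J v x})) \<noteq> 0)"
      unfolding w_def by blast
  qed
qed

section \<open>Rankings for the even and the odd side\<close>

context nbhd_graph
begin

text \<open>All attainable values of an untied vertex have the parity of
  \<open>d v div 2 + card (lower N r v)\<close>, so insensitivity to errors depends on the ranking
  alone. Fewer than \<open>d v div 2\<close> lower neighbours keep these values positive.\<close>

lemma completable_by_ranking:
  fixes r :: "'a \<Rightarrow> nat"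
  assumes ties_unique: "\<And>v x z. x \<in> ties N r v \<Longrightarrow> z \<in> ties N r v \<Longrightarrow> x = z"
    and ties_odd: "\<And>v x. x \<in> ties N r v \<Longrightarrow> odd (d v)"
    and pinned: "\<And>v. v \<in> V \<Longrightarrow> N v \<noteq> {} \<Longrightarrow> ties N r v = {} \<Longrightarrow> odd (d v) \<Longrightarrow>
      even (d v div 2 + card (lower N r v)) \<noteq> q"
    and ties_proper: "\<And>hi y v x. (\<forall>v. ties N r v = {} \<longrightarrow> \<not> hi v) \<Longrightarrow>
      (\<forall>v\<in>V. y v \<in> attainable N d r hi v) \<Longrightarrow>
      (\<forall>v. \<forall>x\<in>lower N r v. round_up q (y x) \<noteq> round_up q (y v)) \<Longrightarrow>
      x \<in> ties N r v \<Longrightarrow> hi v \<Longrightarrow> \<not> hi x \<Longrightarrow>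
      round_up q (y x) \<noteq> round_up q (y v) \<or> N v = {x} \<and> N x = {v} \<and> d x = d v"
    and Z: "\<And>v. v \<in> Z \<Longrightarrow> v \<in> V \<and> ties N r v = {} \<and> card (lower N r v) < d v div 2"
  shows "completable V N d q Z"
proof -
  obtain idx :: "'a \<Rightarrow> nat" where idx: "inj_on idx V"
    using finite_imp_inj_to_nat_seg[OF finite_V] by blast
  define hi where "hi v \<longleftrightarrow> (\<exists>x\<in>ties N r v. idx x < idx v)" for v
  have ties_sym: "v \<in> ties N r x" if "x \<in> ties N r v" for v x
    using that sym by (auto simp: ties_def)
  have hi: "hi x \<longleftrightarrow> \<not> hi v" if x: "x \<in> ties N r v" for v x
  proof -
    have "ties N r v = {x}" "ties N r x = {v}" using ties_unique x ties_sym[OF x] by blast+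
    moreover have "idx x \<noteq> idx v"
      using idx x irrefl nbhd_in sym unfolding inj_on_def ties_def by fast
    ultimately show ?thesis by (auto simp: hi_def)
  qed
  have not_hi: "\<not> hi v" if "ties N r v = {}" for v using that by (simp add: hi_def)
  obtain y where y: "\<And>v. v \<in> V \<Longrightarrow> y v \<in> attainable N d r hi v"
    "\<And>v x. v \<in> V \<Longrightarrow> x \<in> lower N r v \<Longrightarrow> round_up q (y x) \<noteq> round_up q (y v)"
    using greedy_values[of d r hi q] by blast
  have V: "v \<in> V" if "x \<in> N v" for v x using nbhd_in[OF sym[OF that]] .
  have proper: "round_up q (y x) \<noteq> round_up q (y v)" if "x \<in> lower N r v" for v x
    using that y(2)[of v x] V[of x v] by (simp add: lower_def)
  show ?thesis
  proof (rule rank_completable[where r = r and hi = hi and y = y])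
    fix v assume v: "N v \<noteq> {}" "ties N r v = {}" "odd (d v)"
    then have vV: "v \<in> V" using V by blast
    obtain j where j: "j \<le> card (lower N r v)"
      "y v = int (d v div 2) + int (card (lower N r v)) - 2 * int j"
      using y(1)[OF vV] not_hi[OF v(2)] by (auto simp: attainable_def)
    have "even (y v) \<longleftrightarrow> even (int (d v div 2 + card (lower N r v)))" using j(2) by simp
    then have "even (y v) \<longleftrightarrow> even (d v div 2 + card (lower N r v))" by (simp only: even_of_nat)
    then show "round_up q (y v) = y v + 1" using pinned[OF vV v] by (simp add: round_up_def)
  next
    fix v x assume x: "x \<in> ties N r v"
    show "round_up q (y x) \<noteq> round_up q (y v) \<or> N v = {x} \<and> N x = {v} \<and> d x = d v"
    proof (cases "hi v")
      case True
      then show ?thesis using ties_proper[of hi y x v] not_hi y(1) proper x hi[OF x] by blast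
    next
      case False
      then have "round_up q (y v) \<noteq> round_up q (y x) \<or> N x = {v} \<and> N v = {x} \<and> d v = d x"
        using ties_proper[of hi y v x] not_hi y(1) proper ties_sym[OF x] hi[OF x] by blast
      then show ?thesis by metis
    qed
  next
    fix v assume v: "v \<in> Z"
    have "y v \<ge> 1" using y(1)[of v] Z[OF v] by (auto simp: attainable_def)
    then show "v \<in> V \<and> ties N r v = {} \<and> y v \<ge> 1" using Z[OF v] by blast
  qed (use ties_unique ties_odd hi not_hi y proper in blast)+
qed

text \<open>Vertices of degree 3 come first, with value 1. Adjacent vertices of equal odd degree are paired.
  Any other vertex of degree 5 must come after exactly one of its neighbours.\<close>

lemma even_side_completable:
  assumes d: "\<And>v. v \<in> V \<Longrightarrow> d v \<le> 6 \<and> 2 * card (N v) \<le> d v"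
    and one_odd: "\<And>v x z. odd (d v) \<Longrightarrow> x \<in> N v \<Longrightarrow> z \<in> N v \<Longrightarrow> odd (d x) \<Longrightarrow> odd (d z) \<Longrightarrow> x = z"
    and Z: "\<And>v. v \<in> Z \<Longrightarrow> v \<in> V \<and> card (N v) < d v div 2 \<and> (odd (d v) \<longrightarrow> N v = {})"
  shows "completable V N d True Z"
proof -
  obtain idx :: "'a \<Rightarrow> nat" where idx: "inj_on idx V"
    using finite_imp_inj_to_nat_seg[OF finite_V] by blast
  \<comment> \<open>Even vertices get distinct even ranks from 2 on. A vertex of degree 5 with only
    even neighbours takes the odd rank just after the first of them; ranks 0 and 1 precede all even
    vertices.\<close>
  define r where "r v = (if even (d v) then 2 + 2 * idx v
    else if d v = 5 then
      (if \<exists>x\<in>N v. odd (d x) then (if \<exists>x\<in>N v. d x = 3 then 1 else 0) else 3 + 2 * Min (idx ` N v))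
    else 0)" for v
  have V: "v \<in> V" if "x \<in> N v" for v x using nbhd_in[OF sym[OF that]] .
  have odd_cases: "d v = 3 \<or> d v = 5" if "odd (d v)" "x \<in> N v" for v x
  proof -
    have "d v \<le> 6" "2 * card (N v) \<le> d v" "card (N v) > 0"
      using d[OF V[OF that(2)]] that(2) by (auto simp: card_gt_0_iff)
    then have "d v \<in> {2, 3, 4, 5, 6}" by auto
    then show ?thesis using that(1) by auto
  qed
  have three: "N v = {x}" if "d v = 3" "x \<in> N v" for v x
  proof -
    have "card (N v) \<le> 1" using d[OF V[OF that(2)]] that(1) by simp
    then show ?thesis using that(2) card_le_Suc0_iff_eq[OF finite_nbhd] by (metis One_nat_def singletonI subsetI subset_antisym singletonD)
  qed
  have r_even: "r v = 2 + 2 * idx v" if "even (d v)" for v using that by (simp add: r_def)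
  have r3: "r v = 0" if "d v = 3" for v using that by (simp add: r_def)
  have r53: "r v = 1" if "d v = 5" "x \<in> N v" "d x = 3" for v x
  proof -
    have "\<exists>x\<in>N v. odd (d x)" "\<exists>x\<in>N v. d x = 3" using that by (auto intro!: bexI[of _ x])
    then show ?thesis using that(1) by (simp add: r_def)
  qed
  have r55: "r v = 0" if "d v = 5" "x \<in> N v" "d x = 5" for v x
  proof -
    have "\<exists>x\<in>N v. odd (d x)" using that by (auto intro!: bexI[of _ x])
    moreover have "d z \<noteq> 3" if "z \<in> N v" for z
      using one_odd[of v x z] \<open>d v = 5\<close> \<open>x \<in> N v\<close> \<open>d x = 5\<close> that by auto
    ultimately show ?thesis using that(1) by (auto simp: r_def)
  qed
  have r5: "r v = 3 + 2 * Min (idx ` N v)" if "d v = 5" "\<forall>x\<in>N v. even (d x)" for v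
    using that by (auto simp: r_def)
  have even_ties: "ties N r v = {}" if "even (d v)" for v
  proof -
    have "r x \<noteq> r v" if x: "x \<in> N v" for x
    proof (cases "even (d x)")
      case True
      have "idx x \<noteq> idx v" using idx x V[OF x] nbhd_in[OF x] irrefl by (metis inj_onD)
      then show ?thesis using r_even[OF True] r_even[OF \<open>even (d v)\<close>] by simp
    next
      case False
      consider "d x = 3" | "d x = 5" using odd_cases[OF False sym[OF x]] by blast
      then show ?thesis
      proof cases
        case 1
        then show ?thesis using r3 r_even[OF \<open>even (d v)\<close>] by simp
      next
        case 2
        have "r x \<in> {0, 1} \<or> odd (r x)" using 2 by (simp add: r_def)
        then show ?thesis using r_even[OF \<open>even (d v)\<close>] by auto
      qed
    qed
    then show ?thesis by (auto simp: ties_def)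
  qed
  have odd_ties: "d v = d x" "lower N r v = {}" if x: "x \<in> ties N r v" for v x
  proof -
    have xN: "x \<in> N v" and rx: "r x = r v" using x by (auto simp: ties_def)
    have odd: "odd (d v)" "odd (d x)" using even_ties[of v] even_ties[of x] x xN rx sym[OF xN]
      by (auto simp: ties_def)
    consider "d v = 3" "d x = 3" | "d v = 3" "d x = 5" | "d v = 5" "d x = 3" | "d v = 5" "d x = 5"
      using odd_cases[OF odd(1) xN] odd_cases[OF odd(2) sym[OF xN]] by blast
    then have "d v = d x \<and> r v = 0"
    proof cases
      case 1 then show ?thesis using r3 by simp
    next
      case 2 then show ?thesis using r3 r53[of x v] sym[OF xN] rx by simp
    next
      case 3 then show ?thesis using r3 r53[of v x] xN rx by simp
    next
      case 4 then show ?thesis using r55[of v x] xN by simp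
    qed
    then show "d v = d x" "lower N r v = {}" by (auto simp: lower_def)
  qed
  have ties_oddness: "odd (d v)" if "x \<in> ties N r v" for v x
    using even_ties[of v] that by auto
  show ?thesis
  proof (rule completable_by_ranking[where r = r])
    fix v x z assume xz: "x \<in> ties N r v" "z \<in> ties N r v"
    have "odd (d v)" by (rule ties_oddness[OF xz(1)])
    moreover have "x \<in> N v" "z \<in> N v" using xz by (simp_all add: ties_def)
    ultimately show "x = z"
      using one_odd[of v x z] odd_ties(1)[OF xz(1)] odd_ties(1)[OF xz(2)] by metis
  next
    fix v assume v: "v \<in> V" "N v \<noteq> {}" "ties N r v = {}" "odd (d v)"
    then obtain x where x: "x \<in> N v" by blast
    \<comment> \<open>The sum must be odd: degree 3 needs no lower neighbour, degree 5 exactly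
      one.\<close>
    consider "d v = 3" | z where "d v = 5" "z \<in> N v" "d z = 3"
      | z where "d v = 5" "z \<in> N v" "d z = 5" | "d v = 5" "\<forall>z\<in>N v. even (d z)"
      using odd_cases[OF v(4) x] odd_cases sym by metis
    then show "even (d v div 2 + card (lower N r v)) \<noteq> True"
    proof cases
      case 1
      then show ?thesis using r3 by (simp add: lower_def)
    next
      case (2 z)
      have "lower N r v = {z}"
      proof -
        have rr: "r v = 1" "r z = 0" using r53[OF 2] r3[OF 2(3)] by auto
        have "u = z" if u: "u \<in> N v" "r u < 1" for u
        proof -
          have "odd (d u)" using u(2) r_even[of u] by linarith
          moreover have "odd (d z)" using 2(3) by simp
          ultimately show ?thesis by (rule one_odd[OF v(4) u(1) 2(2)])
        qed
        then have "lower N r v \<subseteq> {z}" using rr(1) unfolding lower_def by fastforce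
        moreover have "z \<in> lower N r v" using 2(2) rr by (simp add: lower_def)
        ultimately show ?thesis by blast
      qed
      then show ?thesis using 2 by simp
    next
      case (3 z)
      have "r v = r z" using r55[OF 3] r55[OF 3(3) sym[OF 3(2)] 3(1)] by simp
      then show ?thesis using v(3) 3(2) by (auto simp: ties_def)
    next
      case 4
      define i where "i = Min (idx ` N v)"
      have i: "i \<in> idx ` N v" "\<And>u. u \<in> N v \<Longrightarrow> i \<le> idx u"
        unfolding i_def using v(2) by (intro Min_in) simp_all
      then obtain z where z: "z \<in> N v" "idx z = i" by blast
      have rv: "r v = 3 + 2 * i" using r5 4 by (simp add: i_def)
      have "lower N r v = {z}"
      proof -
        have "u = z" if u: "u \<in> N v" "r u < r v" for u
        proof -
          have "even (d u)" using 4(2) u(1) by blast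
          then have "idx u \<le> i" using u(2) r_even[of u] rv by linarith
          then have "idx u = idx z" using i(2)[OF u(1)] z by simp
          then show ?thesis by (rule inj_onD[OF idx _ nbhd_in[OF u(1)] nbhd_in[OF z(1)]])
        qed
        moreover have "r z < r v" using z r_even[of z] 4(2) rv by simp
        ultimately show ?thesis using z(1) unfolding lower_def by blast
      qed
      then show ?thesis using 4 by simp
    qed
  next
    fix hi y v x
    assume y: "\<forall>v\<in>V. y v \<in> attainable N d r hi v" and x: "x \<in> ties N r v" and hi: "hi v" "\<not> hi x"
    have xN: "x \<in> N v" and vx: "v \<in> ties N r x" using x sym by (auto simp: ties_def)
    \<comment> \<open>For degree 5 the values 3 and 2 round to 4 and 2. For degree 3 both values
      round to 2, and the two vertices are twins.\<close>
    have ys: "y v = int (d v div 2) + 1" "y x = int (d v div 2)"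
      using y V[OF xN] nbhd_in[OF xN] hi odd_ties[OF x] odd_ties(2)[OF vx] by (auto simp: attainable_def)
    consider "d v = 3" | "d v = 5"
      using odd_cases[OF ties_oddness[OF x] xN] by blast
    then show "round_up True (y x) \<noteq> round_up True (y v) \<or> N v = {x} \<and> N x = {v} \<and> d x = d v"
    proof cases
      case 1
      then show ?thesis using three[of v x] three[of x v] xN sym[OF xN] odd_ties(1)[OF x] by simp
    qed (simp add: ys round_up_def)
  next
    fix v assume v: "v \<in> Z"
    have "ties N r v = {}" using even_ties[of v] Z[OF v] by (auto simp: ties_def)
    moreover have "card (lower N r v) \<le> card (N v)" by (intro card_mono) (auto simp: lower_def)
    ultimately show "v \<in> V \<and> ties N r v = {} \<and> card (lower N r v) < d v div 2"
      using Z[OF v] by linarith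
  qed (use ties_oddness in blast)
qed

end

context nbhd_graph
begin

lemma exists_maximal_independent:
  assumes "L \<subseteq> F" "F \<subseteq> V" "\<forall>v\<in>L. N v \<inter> L = {}"
  shows "\<exists>I. L \<subseteq> I \<and> I \<subseteq> F \<and> (\<forall>v\<in>I. N v \<inter> I = {}) \<and> (\<forall>v\<in>F - I. N v \<inter> I \<noteq> {})"
proof -
  define C where "C = {I. L \<subseteq> I \<and> I \<subseteq> F \<and> (\<forall>v\<in>I. N v \<inter> I = {})}"
  have "C \<subseteq> Pow V" using assms(2) by (auto simp: C_def)
  then have "finite C" by (rule finite_subset) (simp add: finite_V)
  moreover have "C \<noteq> {}" using assms by (auto simp: C_def)
  ultimately obtain I where I: "I \<in> C" "\<And>J. J \<in> C \<Longrightarrow> I \<subseteq> J \<Longrightarrow> I = J"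
    using finite_has_maximal by metis
  have "N v \<inter> I \<noteq> {}" if v: "v \<in> F - I" for v
  proof
    assume "N v \<inter> I = {}"
    moreover have "v \<notin> N x" if "x \<in> I" for x using sym \<open>N v \<inter> I = {}\<close> that by blast
    ultimately have "insert v I \<in> C" using I(1) v irrefl by (auto simp: C_def)
    then show False using I(2)[of "insert v I"] v by blast
  qed
  then show ?thesis using I(1) by (auto simp: C_def)
qed

text \<open>The vertices of degree 5 in a maximal independent set \<open>I\<close> come first, with value 2. Any other
  vertex of degree 5 has two neighbours, one of them in \<open>I\<close>; it comes after both, or it is paired with
  the other one.\<close>

lemma odd_side_completable:
  assumes d: "\<And>v. v \<in> V \<Longrightarrow> d v \<le> 6 \<and> 2 * card (N v) \<le> d v"
  shows "completable V N d False {}"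
proof -
  have V: "v \<in> V" if "x \<in> N v" for v x using nbhd_in[OF sym[OF that]] .
  obtain idx :: "'a \<Rightarrow> nat" and n where idx: "inj_on idx V" and n: "idx ` V = {i. i < n}"
    using finite_imp_inj_to_nat_seg[OF finite_V] by metis
  have idx_n: "idx v < n" if "v \<in> V" for v using n that by blast
  \<comment> \<open>Isolated edges between two vertices of degree 5 are set apart; they fall under
    the exception in \<open>ties_proper\<close>.\<close>
  define twin where "twin v \<longleftrightarrow> d v = 5 \<and> (\<exists>x. N v = {x} \<and> N x = {v} \<and> d x = 5)" for v
  define F where "F = {v \<in> V. d v = 5 \<and> \<not> twin v}"
  \<comment> \<open>Forcing these vertices into \<open>I\<close> leaves exactly two neighbours to
    every vertex of \<open>F - I\<close>. Two adjacent ones would be twins, so \<open>L\<close> is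
    independent.\<close>
  define L where "L = {v \<in> F. card (N v) = 1}"
  have "\<forall>v\<in>L. N v \<inter> L = {}"
  proof (rule ballI, rule ccontr)
    fix v assume v: "v \<in> L" "N v \<inter> L \<noteq> {}"
    then obtain x where x: "x \<in> N v" "x \<in> L" by blast
    have "N v = {x}" using v(1) x(1) by (auto simp: L_def card_1_singleton_iff)
    moreover have "N x = {v}" using x(2) sym[OF x(1)] by (auto simp: L_def card_1_singleton_iff)
    ultimately have "twin v" using v(1) x(2) by (simp add: twin_def L_def F_def)
    then show False using v(1) by (simp add: L_def F_def)
  qed
  then have "\<exists>I. L \<subseteq> I \<and> I \<subseteq> F \<and> (\<forall>v\<in>I. N v \<inter> I = {}) \<and> (\<forall>v\<in>F - I. N v \<inter> I \<noteq> {})"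
    by (intro exists_maximal_independent) (auto simp: L_def F_def)
  then obtain I where "L \<subseteq> I \<and> I \<subseteq> F \<and> (\<forall>v\<in>I. N v \<inter> I = {}) \<and> (\<forall>v\<in>F - I. N v \<inter> I \<noteq> {})"
    by (elim exE)
  then have I: "L \<subseteq> I" "I \<subseteq> F" "\<And>v. v \<in> I \<Longrightarrow> N v \<inter> I = {}"
    "\<And>v. v \<in> F - I \<Longrightarrow> N v \<inter> I \<noteq> {}"
    by simp_all
  define P where "P v \<longleftrightarrow> (\<exists>x\<in>N v. d x = 3 \<or> x \<in> F - I)" for v
  \<comment> \<open>Odd vertices neither in \<open>I\<close> nor twins come after all even ones.
    Those with a partner share rank \<open>n + 2\<close>; a non-isolated one without a partner has
    all its neighbours below it.\<close>
  define r where "r v = (if v \<in> I \<or> twin v then 0 else if even (d v) then 1 + idx v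
    else if P v then n + 2 else if d v = 5 then n + 1 else n + 3)" for v
  have I5: "d v = 5" "\<not> twin v" "v \<in> V" if "v \<in> I" for v using I(2) that by (auto simp: F_def)
  have twin5: "d v = 5" if "twin v" for v using that by (simp add: twin_def)
  have twin_nbr: "twin x" "N v = {x}" "N x = {v}" if "twin v" "x \<in> N v" for v x
    using that by (auto simp: twin_def)
  have r_zero: "r v = 0" if "v \<in> I \<or> twin v" for v using that by (simp add: r_def)
  have r_even: "r v = 1 + idx v" if "even (d v)" for v
  proof -
    have "\<not> (v \<in> I \<or> twin v)" using I5(1) twin5 that by auto
    then show ?thesis using that by (simp add: r_def)
  qed
  have r_P: "r v = n + 2" if "v \<in> F - I \<or> d v = 3" "P v" for v
    using that twin5[of v] I5(1)[of v] by (auto simp: r_def F_def)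
  have r_five: "r v = n + 1" if "v \<in> F - I" "\<not> P v" for v
    using that by (simp add: r_def F_def)
  have r_three: "r v = n + 3" if "d v = 3" "\<not> P v" for v
    using that twin5[of v] I5(1)[of v] by (auto simp: r_def)
  have classes: "even (d v) \<or> v \<in> I \<or> twin v \<or> v \<in> F - I \<or> d v = 3" if "x \<in> N v" for v x
  proof -
    have "card (N v) > 0" using that by (auto simp: card_gt_0_iff)
    then have "d v \<in> {2, 3, 4, 5, 6}" using d[OF V[OF that]] by auto
    then show ?thesis using V[OF that] by (auto simp: F_def)
  qed
  have two: "\<exists>i x. N v = {i, x} \<and> i \<in> I \<and> i \<noteq> x" if v: "v \<in> F - I" for v
  proof -
    obtain i where i: "i \<in> N v" "i \<in> I" using I(4)[OF v] by blast
    have "card (N v) \<noteq> 1" using v I(1) by (auto simp: L_def)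
    moreover have "card (N v) \<le> 2" using v d[of v] by (auto simp: F_def)
    moreover have "card (N v) > 0" using i by (auto simp: card_gt_0_iff)
    ultimately have "card (N v) = 2" by linarith
    then obtain a b where "N v = {a, b}" "a \<noteq> b" by (auto simp: card_2_iff)
    then show ?thesis using i by auto
  qed
  have single: "N v = {x}" if "d v = 3" "x \<in> N v" for v x
  proof -
    have "card (N v) \<le> Suc 0" using d[OF V[OF that(2)]] that(1) by simp
    then show ?thesis using that(2) card_le_Suc0_iff_eq[OF finite_nbhd] by blast
  qed
  have P_sym: "P x" if "x \<in> N v" "v \<in> F - I \<or> d v = 3" for v x
    using sym[OF that(1)] that(2) by (auto simp: P_def)
  have not_twin: "\<not> twin x" if "x \<in> N v" "\<not> twin v" for v x
    using twin_nbr(1)[OF _ sym[OF that(1)]] that(2) by blast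
  have r_low: "r x < n + 1" if "x \<in> N v" "\<not> (x \<in> F - I \<or> d x = 3)" for v x
    using classes[OF sym[OF that(1)]] that(2) r_zero[of x] r_even[of x] idx_n[OF nbhd_in[OF that(1)]]
    by auto
  have even_case: "ties N r v = {}" if v: "even (d v)" for v
  proof -
    have "r x \<noteq> r v" if x: "x \<in> N v" for x
    proof -
      have rv: "r v = 1 + idx v" "idx v < n" using r_even[OF v] idx_n[OF V[OF x]] by auto
      consider "even (d x)" | "x \<in> I \<or> twin x" | "x \<in> F - I \<or> d x = 3"
        using classes[OF sym[OF x]] by blast
      then show ?thesis
      proof cases
        case 1
        have "idx x \<noteq> idx v" using inj_onD[OF idx _ nbhd_in[OF x] V[OF x]] x irrefl by blast
        then show ?thesis using r_even[OF 1] rv by simp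
      next
        case 2
        then show ?thesis using r_zero rv by simp
      next
        case 3
        then show ?thesis using r_P[of x] r_five[of x] r_three[of x] rv by fastforce
      qed
    qed
    then show ?thesis by (auto simp: ties_def)
  qed
  have I_case: "ties N r v = {}" "lower N r v = {}" if v: "v \<in> I" for v
  proof -
    have "r x \<noteq> 0" if x: "x \<in> N v" for x
    proof -
      have "x \<notin> I" "\<not> twin x" using I(3)[OF v] x not_twin[OF x I5(2)[OF v]] by auto
      then show ?thesis by (simp add: r_def)
    qed
    then show "ties N r v = {}" "lower N r v = {}"
      using r_zero[of v] v by (auto simp: ties_def lower_def)
  qed
  have twin_case: "ties N r v = N v" if v: "twin v" for v
    using r_zero[of v] r_zero twin_nbr(1)[OF v] v by (auto simp: ties_def)
  have pair_case: "\<exists>i x. N v = {i, x} \<and> i \<in> I \<and> ties N r v = {x} \<and> lower N r v = {i}"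
    if v: "v \<in> F - I" "P v" for v
  proof -
    obtain i x where ix: "N v = {i, x}" "i \<in> I" "i \<noteq> x" using two[OF v(1)] by blast
    have "d i \<noteq> 3" "i \<notin> F - I" using I5(1)[OF ix(2)] ix(2) by auto
    then have "d x = 3 \<or> x \<in> F - I" using v(2) ix(1) by (auto simp: P_def)
    moreover have "P x" using P_sym[of x v] ix(1) v(1) by blast
    ultimately have "r x = n + 2" using r_P by blast
    moreover have "r v = n + 2" "r i = 0" using r_P v r_zero ix(2) by blast+
    ultimately have "ties N r v = {x}" "lower N r v = {i}" using ix by (auto simp: ties_def lower_def)
    then show ?thesis using ix by blast
  qed
  have free_case: "ties N r v = {}" "card (lower N r v) = 2" if v: "v \<in> F - I" "\<not> P v" for v
  proof -
    have "r x < r v" if "x \<in> N v" for x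
      using r_low[OF that] v that r_five[OF v] by (auto simp: P_def)
    then have "\<forall>x\<in>N v. r x < r v" by blast
    then have "ties N r v = {}" "lower N r v = N v" by (auto simp: ties_def lower_def)
    moreover have "card (N v) = 2" using two[OF v(1)] by auto
    ultimately show "ties N r v = {}" "card (lower N r v) = 2" by auto
  qed
  have three_case: "N v = {x} \<and> (ties N r v = {x} \<and> lower N r v = {} \<and> (x \<in> F - I \<and> P x \<or> d x = 3) \<or>
      ties N r v = {} \<and> lower N r v = {x})" if v: "d v = 3" "x \<in> N v" for v x
  proof -
    have Nv: "N v = {x}" using single[OF v] .
    show ?thesis
    proof (cases "P v")
      case True
      then have x: "d x = 3 \<or> x \<in> F - I" using Nv by (auto simp: P_def)
      moreover have "P x" using P_sym[OF v(2)] v(1) by blast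
      moreover have "r v = n + 2" using r_P True v(1) by blast
      moreover have "r x = n + 2" using r_P x \<open>P x\<close> by blast
      ultimately show ?thesis using Nv by (auto simp: ties_def lower_def)
    next
      case False
      then have "\<not> (x \<in> F - I \<or> d x = 3)" using v(2) by (auto simp: P_def)
      then have "r x < n + 1" using r_low[OF v(2)] by blast
      then show ?thesis using Nv r_three[OF v(1) False] by (auto simp: ties_def lower_def)
    qed
  qed
  have cases_nonempty: thesis
    if "x \<in> N v" "even (d v) \<Longrightarrow> thesis" "v \<in> I \<Longrightarrow> thesis" "twin v \<Longrightarrow> thesis"
      "v \<in> F - I \<Longrightarrow> P v \<Longrightarrow> thesis" "v \<in> F - I \<Longrightarrow> \<not> P v \<Longrightarrow> thesis" "d v = 3 \<Longrightarrow> thesis"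
    for x v thesis
    using classes[OF that(1)] that(2-) by blast
  have ties_cases: thesis
    if x: "x \<in> ties N r v" and "twin v \<Longrightarrow> N v = {x} \<Longrightarrow> N x = {v} \<Longrightarrow> d v = 5 \<Longrightarrow> d x = 5 \<Longrightarrow> thesis"
      "\<And>i. v \<in> F - I \<Longrightarrow> P v \<Longrightarrow> lower N r v = {i} \<Longrightarrow> i \<in> I \<Longrightarrow> ties N r v = {x} \<Longrightarrow> thesis"
      "d v = 3 \<Longrightarrow> lower N r v = {} \<Longrightarrow> N v = {x} \<Longrightarrow> ties N r v = {x} \<Longrightarrow> thesis"
    for x v thesis
  proof -
    have xN: "x \<in> N v" using x by (simp add: ties_def)
    show thesis
    proof (rule cases_nonempty[OF xN])
      assume "twin v"
      then show thesis using that(2) twin_nbr[OF _ xN] twin5 by blast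
    next
      assume v: "v \<in> F - I" "P v"
      then show thesis using pair_case[OF v] x that(3) by auto
    next
      assume "d v = 3"
      then show thesis using three_case[OF _ xN] x that(4) by auto
    qed (use even_case I_case free_case x in auto)
  qed
  show ?thesis
  proof (rule completable_by_ranking[where r = r])
    fix v x z assume x: "x \<in> ties N r v" and z: "z \<in> ties N r v"
    have zN: "z \<in> N v" using z by (simp add: ties_def)
    show "x = z"
    proof (rule ties_cases[OF x])
      assume "N v = {x}"
      then show ?thesis using zN by simp
    qed (use z in simp_all)
  next
    fix v x assume x: "x \<in> ties N r v"
    show "odd (d v)" using even_case[of v] x by blast
  next
    fix v assume v: "v \<in> V" "N v \<noteq> {}" "ties N r v = {}" "odd (d v)"
    then obtain x where x: "x \<in> N v" by blast
    \<comment> \<open>Degree 5 needs 0 or 2 lower neighbours, degree 3 needs 1: vertices of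
      \<open>I\<close> precede their neighbours, the other unpaired ones follow theirs.\<close>
    have "even (d v div 2 + card (lower N r v))"
    proof (rule cases_nonempty[OF x])
      assume "v \<in> I" then show ?thesis using I_case(2) I5(1) by simp
    next
      assume "twin v" then show ?thesis using twin_case v by blast
    next
      assume *: "v \<in> F - I" "P v" then show ?thesis using pair_case[OF *] v(3) by auto
    next
      assume *: "v \<in> F - I" "\<not> P v" then show ?thesis using free_case(2)[OF *] by (auto simp: F_def)
    next
      assume *: "d v = 3" then show ?thesis using three_case[OF * x] v(3) by auto
    qed (use v in blast)
    then show "even (d v div 2 + card (lower N r v)) \<noteq> False" by simp
  next
    fix hi y v x
    assume not_hi: "\<forall>v. ties N r v = {} \<longrightarrow> \<not> hi v"
      and y: "\<forall>v\<in>V. y v \<in> attainable N d r hi v"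
      and proper: "\<forall>v. \<forall>x\<in>lower N r v. round_up False (y x) \<noteq> round_up False (y v)"
      and x: "x \<in> ties N r v" and hi: "hi v" "\<not> hi x"
    have xN: "x \<in> N v" and vx: "v \<in> ties N r x" using x sym by (auto simp: ties_def)
    have yI: "y i = 2" if "i \<in> I" for i
    proof -
      have "y i \<in> attainable N d r hi i" using y I5(3)[OF that] by blast
      then show ?thesis using I_case[OF that] not_hi I5(1)[OF that] by (simp add: attainable_def)
    qed
    \<comment> \<open>The two attainable values round to 5 and 3 with \<open>hi\<close>, to 3 and 1
      without; the neighbour in \<open>I\<close> already occupies 3.\<close>
    have pair_value: "round_up False (y u) = (if hi u then 5 else 1)"
      if u: "u \<in> F - I" "lower N r u = {i}" "i \<in> I" for u i
    proof -
      have "y u \<in> attainable N d r hi u" "d u = 5" using y u(1) by (auto simp: F_def)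
      then obtain j where j: "j \<in> {..Suc 0}" "y u = 3 + of_bool (hi u) - 2 * int j"
        unfolding attainable_def using u(2) by (elim imageE) simp
      then have "j = 0 \<or> j = 1" by auto
      moreover have "round_up False (y u) \<noteq> 3"
      proof -
        have "i \<in> lower N r u" using u(2) by simp
        then have "round_up False (y i) \<noteq> round_up False (y u)" using proper by blast
        moreover have "round_up False (y i) = 3" using yI[OF u(3)] by (simp add: round_up_def)
        ultimately show ?thesis by simp
      qed
      ultimately show ?thesis using j(2) by (cases "hi u") (auto simp: round_up_def)
    qed
    have three_value: "round_up False (y u) = (if hi u then 3 else 1)"
      if u: "d u = 3" "lower N r u = {}" "u \<in> V" for u
    proof -
      have "y u \<in> attainable N d r hi u" using y u(3) by blast
      then show ?thesis using u by (auto simp: attainable_def round_up_def)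
    qed
    show "round_up False (y x) \<noteq> round_up False (y v) \<or> N v = {x} \<and> N x = {v} \<and> d x = d v"
    proof (rule ties_cases[OF x])
      fix i assume v: "v \<in> F - I" "lower N r v = {i}" "i \<in> I"
      then have yv: "round_up False (y v) = 5" using pair_value hi by simp
      show ?thesis
      proof (rule ties_cases[OF vx])
        fix i assume "x \<in> F - I" "lower N r x = {i}" "i \<in> I"
        then show ?thesis using pair_value hi yv by simp
      next
        assume "d x = 3" "lower N r x = {}"
        then show ?thesis using three_value hi yv nbhd_in[OF xN] by simp
      qed simp
    next
      assume v: "d v = 3" "lower N r v = {}" "N v = {x}"
      then have yv: "round_up False (y v) = 3" using three_value hi V[OF xN] by simp
      show ?thesis
      proof (rule ties_cases[OF vx])
        fix i assume "x \<in> F - I" "lower N r x = {i}" "i \<in> I"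
        then show ?thesis using pair_value hi yv by simp
      next
        assume "d x = 3" "lower N r x = {}"
        then show ?thesis using three_value hi yv nbhd_in[OF xN] by simp
      qed (use v in simp)
    qed simp
  qed simp
qed

end

section \<open>Deleting vertices from a maximum cut\<close>

text \<open>The increase of the cut when \<open>X\<close> is flipped.\<close>

definition imbalance :: "('a \<Rightarrow> 'a set) \<Rightarrow> ('a \<Rightarrow> bool) \<Rightarrow> 'a set \<Rightarrow> int" where
  "imbalance N side X = (\<Sum>v\<in>X. \<Sum>x\<in>N v - X. if side x = side v then 1 else -1)"

context nbhd_graph
begin

lemma balanced_iff_imbalance: "balanced V N side \<longleftrightarrow> (\<forall>X\<subseteq>V. imbalance N side X \<le> 0)"
proof -
  have "imbalance N side X = int (\<Sum>v\<in>X. card (same N side v - X)) - int (\<Sum>v\<in>X. card (other N side v - X))"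
    for X
  proof -
    have "(\<Sum>x\<in>N v - X. if side x = side v then 1 else -1) =
        int (card (same N side v - X)) - int (card (other N side v - X))" for v
    proof -
      have "N v - X = (same N side v - X) \<union> (other N side v - X)" by (auto simp: same_def other_def)
      moreover have "(\<Sum>x\<in>(same N side v - X) \<union> (other N side v - X). if side x = side v then 1 else -1 :: int) =
          (\<Sum>x\<in>same N side v - X. if side x = side v then 1 else -1) +
          (\<Sum>x\<in>other N side v - X. if side x = side v then 1 else -1)"
        by (intro sum.union_disjoint) (auto simp: same_def other_def)
      moreover have "(\<Sum>x\<in>same N side v - X. if side x = side v then 1 else -1 :: int) = int (card (same N side v - X))"
        by (simp add: same_def)
      moreover have "(\<Sum>x\<in>other N side v - X. if side x = side v then 1 else -1 :: int) = - int (card (other N side v - X))"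
        by (simp add: other_def)
      ultimately show ?thesis by simp
    qed
    then show ?thesis by (simp add: imbalance_def sum_subtractf)
  qed
  then show ?thesis unfolding balanced_def by (simp del: of_nat_sum)
qed

lemma exists_balanced: "\<exists>side. balanced V N side"
proof -
  \<comment> \<open>A largest cut is taken. Each edge is counted at both ends, hence the factor 2
    before the imbalance below.\<close>
  define cut where "cut S = (\<Sum>v\<in>V. \<Sum>x\<in>N v. of_bool ((v \<in> S) \<noteq> (x \<in> S)) :: int)" for S
  have "finite (cut ` Pow V)" "cut ` Pow V \<noteq> {}" using finite_V by auto
  then obtain S where S: "S \<subseteq> V" "\<And>R. R \<subseteq> V \<Longrightarrow> cut R \<le> cut S"
    using Max_in[of "cut ` Pow V"] Max_ge[of "cut ` Pow V"] by (metis (no_types, lifting) PowD PowI image_iff)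
  define side where "side v \<longleftrightarrow> v \<in> S" for v
  have "imbalance N side X \<le> 0" if X: "X \<subseteq> V" for X
  proof -
    define \<delta> where "\<delta> v x = (if side x = side v then 1 else -1 :: int)" for v x
    define R where "R = (S - X) \<union> (X - S)"
    have finX: "finite X" using X finite_V by (rule finite_subset)
    have flip: "of_bool ((v \<in> R) \<noteq> (x \<in> R)) = of_bool ((v \<in> S) \<noteq> (x \<in> S)) +
        of_bool ((v \<in> X) \<noteq> (x \<in> X)) * \<delta> v x" for v x
      by (auto simp: R_def \<delta>_def side_def)
    have "cut R = cut S + (\<Sum>v\<in>V. \<Sum>x\<in>N v. of_bool ((v \<in> X) \<noteq> (x \<in> X)) * \<delta> v x)"
      unfolding cut_def flip by (simp add: sum.distrib)
    moreover have "(\<Sum>v\<in>V. \<Sum>x\<in>N v. of_bool ((v \<in> X) \<noteq> (x \<in> X)) * \<delta> v x) = 2 * imbalance N side X"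
    proof -
      have "(\<Sum>v\<in>V. \<Sum>x\<in>N v. of_bool ((v \<in> X) \<noteq> (x \<in> X)) * \<delta> v x) =
          (\<Sum>v\<in>X. \<Sum>x\<in>N v. of_bool (x \<notin> X) * \<delta> v x) + (\<Sum>v\<in>V - X. \<Sum>x\<in>N v. of_bool (x \<in> X) * \<delta> v x)"
        using sum.subset_diff[OF X finite_V, of "\<lambda>v. \<Sum>x\<in>N v. of_bool ((v \<in> X) \<noteq> (x \<in> X)) * \<delta> v x"]
        by simp
      moreover have "(\<Sum>x\<in>N v. of_bool (x \<notin> X) * \<delta> v x) = (\<Sum>x\<in>N v - X. \<delta> v x)" for v
        by (intro sum.mono_neutral_cong_right) auto
      moreover have "(\<Sum>v\<in>V - X. \<Sum>x\<in>N v. of_bool (x \<in> X) * \<delta> v x) = (\<Sum>v\<in>X. \<Sum>x\<in>N v - X. \<delta> v x)"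
      proof -
        have "(\<Sum>v\<in>V - X. \<Sum>x\<in>N v. of_bool (x \<in> X) * \<delta> v x) =
            (\<Sum>v\<in>V - X. \<Sum>x\<in>X. of_bool (x \<in> N v) * \<delta> v x)"
        proof (rule sum.cong[OF refl])
          fix v
          have "(\<Sum>x\<in>N v. of_bool (x \<in> X) * \<delta> v x) = (\<Sum>x\<in>N v \<inter> X. \<delta> v x)"
            by (intro sum.mono_neutral_cong_right) auto
          also have "\<dots> = (\<Sum>x\<in>X. of_bool (x \<in> N v) * \<delta> v x)"
            using finX by (intro sum.mono_neutral_cong_left) auto
          finally show "(\<Sum>x\<in>N v. of_bool (x \<in> X) * \<delta> v x) = (\<Sum>x\<in>X. of_bool (x \<in> N v) * \<delta> v x)" .
        qed
        also have "\<dots> = (\<Sum>x\<in>X. \<Sum>v\<in>V - X. of_bool (x \<in> N v) * \<delta> v x)" by (rule sum.swap)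
        also have "\<dots> = (\<Sum>x\<in>X. \<Sum>v\<in>N x - X. \<delta> x v)"
        proof (rule sum.cong[OF refl])
          fix x
          show "(\<Sum>v\<in>V - X. of_bool (x \<in> N v) * \<delta> v x) = (\<Sum>v\<in>N x - X. \<delta> x v)"
            using finite_V sym nbhd_in by (intro sum.mono_neutral_cong_right) (auto simp: \<delta>_def)
        qed
        finally show ?thesis .
      qed
      moreover have "imbalance N side X = (\<Sum>v\<in>X. \<Sum>x\<in>N v - X. \<delta> v x)"
        by (simp add: imbalance_def \<delta>_def)
      ultimately show ?thesis by simp
    qed
    moreover have "cut R \<le> cut S" using S X by (intro S(2)) (auto simp: R_def)
    ultimately show ?thesis by simp
  qed
  then show ?thesis using balanced_iff_imbalance by blast
qed

end

definition delete :: "('a \<Rightarrow> 'a set) \<Rightarrow> 'a set \<Rightarrow> 'a \<Rightarrow> 'a set" where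
  "delete N W v = (if v \<in> W then {} else N v - W)"

context nbhd_graph
begin

lemma nbhd_graph_delete: "nbhd_graph (V - W) (delete N W)"
  using finite_V nbhd_in irrefl sym by unfold_locales (auto simp: delete_def split: if_splits)

lemma nbhd_graph_same: "nbhd_graph V (same N side)"
  using finite_V nbhd_in irrefl sym by unfold_locales (auto simp: same_def)

lemma same_le_other:
  assumes "balanced V N side" "v \<in> V"
  shows "card (same N side v) \<le> card (other N side v)"
proof -
  have "{v} \<subseteq> V" using assms(2) by simp
  then have "card (same N side v - {v}) \<le> card (other N side v - {v})"
    using assms(1)[unfolded balanced_def, rule_format, of "{v}"] by simp
  moreover have "same N side v - {v} = same N side v" "other N side v - {v} = other N side v"
    using irrefl by (auto simp: same_def other_def)
  ultimately show ?thesis by simp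
qed

text \<open>A vertex of \<open>W\<close> has exactly one more neighbour on the opposite side than on its own side,
  so after any improvement of the cut of the rest it could be put back without loss.\<close>

lemma balanced_delete:
  assumes bal: "balanced V N side" and W: "W \<subseteq> V" "\<And>w. w \<in> W \<Longrightarrow> N w \<inter> W = {}"
    and tight: "\<And>w. w \<in> W \<Longrightarrow> card (other N side w) = card (same N side w) + 1"
  shows "balanced (V - W) (delete N W) side"
proof -
  interpret D: nbhd_graph "V - W" "delete N W" by (rule nbhd_graph_delete)
  define \<delta> where "\<delta> v x = (if side x = side v then 1 else -1 :: int)" for v x
  have finW: "finite W" using W(1) finite_V by (rule finite_subset)
  have "imbalance (delete N W) side X \<le> 0" if X: "X \<subseteq> V - W" for X
  proof -
    have finX: "finite X" by (rule finite_subset[OF X]) (simp add: finite_V)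
    \<comment> \<open>The contribution of \<open>w\<close> to the imbalance if \<open>w\<close> is
      flipped together with \<open>X\<close>; \<open>\<alpha> w\<close> is its contribution if it
      stays.\<close>
    define \<beta> where "\<beta> w = (\<Sum>x\<in>N w - X. \<delta> w x)" for w
    define \<alpha> where "\<alpha> w = (\<Sum>x\<in>N w \<inter> X. \<delta> w x)" for w
    have \<alpha>\<beta>: "\<alpha> w + \<beta> w = -1" if w: "w \<in> W" for w
    proof -
      have "N w = same N side w \<union> other N side w" by (auto simp: same_def other_def)
      moreover have "(\<Sum>x\<in>same N side w \<union> other N side w. \<delta> w x) =
          (\<Sum>x\<in>same N side w. \<delta> w x) + (\<Sum>x\<in>other N side w. \<delta> w x)"
        by (intro sum.union_disjoint) (auto simp: same_def other_def)
      moreover have "(\<Sum>x\<in>same N side w. \<delta> w x) = int (card (same N side w))"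
        by (simp add: \<delta>_def same_def)
      moreover have "(\<Sum>x\<in>other N side w. \<delta> w x) = - int (card (other N side w))"
        by (simp add: \<delta>_def other_def)
      ultimately have "(\<Sum>x\<in>N w. \<delta> w x) = -1" using tight[OF w] by simp
      moreover have "(\<Sum>x\<in>N w. \<delta> w x) = \<alpha> w + \<beta> w"
        unfolding \<alpha>_def \<beta>_def by (subst sum.Int_Diff[of "N w" _ X]) simp_all
      ultimately show ?thesis by simp
    qed
    \<comment> \<open>As \<open>\<alpha> w + \<beta> w = -1\<close> for integers, one of them is
      nonnegative. Flipping just the vertices of \<open>W1\<close> along with \<open>X\<close> makes
      every contribution from \<open>W\<close> nonnegative.\<close>
    define W1 where "W1 = {w \<in> W. \<beta> w \<ge> 0}"
    define Y where "Y = X \<union> W1"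
    have "imbalance N side Y = (\<Sum>v\<in>X. \<Sum>x\<in>N v - Y. \<delta> v x) + (\<Sum>v\<in>W1. \<Sum>x\<in>N v - Y. \<delta> v x)"
      unfolding imbalance_def \<delta>_def[symmetric]
      unfolding Y_def using finX finW X by (intro sum.union_disjoint) (auto simp: W1_def)
    moreover have "(\<Sum>v\<in>W1. \<Sum>x\<in>N v - Y. \<delta> v x) = (\<Sum>w\<in>W1. \<beta> w)"
    proof (rule sum.cong[OF refl])
      fix w assume "w \<in> W1"
      then have "N w - Y = N w - X" using W(2)[of w] by (auto simp: W1_def Y_def)
      then show "(\<Sum>x\<in>N w - Y. \<delta> w x) = \<beta> w" by (simp add: \<beta>_def)
    qed
    moreover have "(\<Sum>v\<in>X. \<Sum>x\<in>N v - Y. \<delta> v x) =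
        imbalance (delete N W) side X + (\<Sum>w\<in>W - W1. \<alpha> w)"
    proof -
      have "(\<Sum>x\<in>N v - Y. \<delta> v x) = (\<Sum>x\<in>delete N W v - X. \<delta> v x) + (\<Sum>x\<in>N v \<inter> (W - W1). \<delta> v x)"
        if v: "v \<in> X" for v
      proof -
        have "N v - Y = (delete N W v - X) \<union> (N v \<inter> (W - W1))"
          using X v by (auto simp: delete_def Y_def W1_def)
        moreover have "(\<Sum>x\<in>(delete N W v - X) \<union> (N v \<inter> (W - W1)). \<delta> v x) =
            (\<Sum>x\<in>delete N W v - X. \<delta> v x) + (\<Sum>x\<in>N v \<inter> (W - W1). \<delta> v x)"
          by (rule sum.union_disjoint) (auto simp: delete_def)
        ultimately show ?thesis by simp
      qed
      moreover have "(\<Sum>v\<in>X. \<Sum>x\<in>N v \<inter> (W - W1). \<delta> v x) = (\<Sum>w\<in>W - W1. \<alpha> w)"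
      proof -
        have "(\<Sum>x\<in>N v \<inter> (W - W1). \<delta> v x) = (\<Sum>w\<in>W - W1. of_bool (w \<in> N v) * \<delta> v w)" for v
          using finW by (intro sum.mono_neutral_cong_left) auto
        moreover have "(\<Sum>v\<in>X. of_bool (w \<in> N v) * \<delta> v w) = \<alpha> w" for w
          unfolding \<alpha>_def using finX sym by (intro sum.mono_neutral_cong_right) (auto simp: \<delta>_def)
        ultimately show ?thesis
          using sum.swap[of "\<lambda>v w. of_bool (w \<in> N v) * \<delta> v w" "W - W1" X] by simp
      qed
      ultimately show ?thesis by (simp add: imbalance_def \<delta>_def[symmetric] sum.distrib)
    qed
    moreover have "(\<Sum>w\<in>W - W1. \<alpha> w) \<ge> 0"
    proof (rule sum_nonneg)
      fix w assume "w \<in> W - W1"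
      then show "0 \<le> \<alpha> w" using \<alpha>\<beta>[of w] by (auto simp: W1_def)
    qed
    moreover have "(\<Sum>w\<in>W1. \<beta> w) \<ge> 0" by (rule sum_nonneg) (simp add: W1_def)
    moreover have "Y \<subseteq> V" using X W(1) by (auto simp: Y_def W1_def)
    ultimately show ?thesis using bal[unfolded balanced_iff_imbalance, rule_format, of Y] by linarith
  qed
  then show ?thesis using D.balanced_iff_imbalance by blast
qed

end

section \<open>Combining both sides\<close>

lemma even_round_up: "even (round_up q n) \<longleftrightarrow> q"
  by (auto simp: round_up_def)

lemma round_up_of_nat: "round_up q (int n) = int n \<or> round_up q (int n) = int n + 1"
  by (simp add: round_up_def)

context nbhd_graph
begin

lemma nbhd_graph_half: "nbhd_graph {v \<in> V. side v = s} (\<lambda>v. if side v = s then same N side v else {})"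
  using finite_V nbhd_in irrefl sym by unfold_locales (auto simp: same_def split: if_splits)

text \<open>The two plans live on disjoint vertex sets and are merged by looking at the side of each
  vertex. \<open>cross_factor\<close> supplies the cut edges, the plans supply the others, and
  across the cut the parities differ.\<close>

lemma completable_sides:
  assumes bal: "balanced V N side"
    and comp: "\<And>s. completable {v \<in> V. side v = s} (\<lambda>v. if side v = s then same N side v else {})
      (\<lambda>v. card (N v)) s (Z s)"
  shows "\<exists>F. (\<forall>v x. F v x \<longleftrightarrow> F x v) \<and>
    (\<forall>v\<in>V. \<forall>x\<in>N v. round_up (side v) (int (card {z \<in> N v. F v z})) \<noteq>
      round_up (side x) (int (card {z \<in> N x. F x z}))) \<and>
    (\<forall>v\<in>V. v \<in> Z (side v) \<longrightarrow> round_up (side v) (int (card {z \<in> N v. F v z})) \<noteq> 0)"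
proof -
  define H where "H s v = (if side v = s then same N side v else {})" for s v
  define d where "d v = card (N v)" for v
  have "\<forall>s. \<exists>pay mate bad U. payment_plan {v \<in> V. side v = s} (H s) d s (Z s) pay mate bad U"
    using comp unfolding completable_def H_def[abs_def] d_def[abs_def] by blast
  then obtain pay mate bad U where
    plan: "\<And>s. payment_plan {v \<in> V. side v = s} (H s) d s (Z s) (pay s) (mate s) (bad s) (U s)"
    by metis
  have U: "\<And>s. U s \<subseteq> {v \<in> V. side v = s}" "\<And>s. paired d (mate s) (U s)"
    and pay: "\<And>s v x. x \<in> H s v \<Longrightarrow> pay s v x \<longleftrightarrow> \<not> pay s x v"
    using plan unfolding payment_plan_def by blast+
  define pay' where "pay' v = pay (side v) v" for v
  define mate' where "mate' v = mate (side v) v" for v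
  define bad' where "bad' v = bad (side v) v" for v
  have U_side: "side v = s" if "v \<in> U s" for v s using U(1)[of s] that by blast
  have mate_U: "mate s v \<in> U s" if "v \<in> U s" for v s using U(2)[of s] that by (simp add: paired_def)
  have paid': "paid pay' (same N side) v = paid (pay (side v)) (H (side v)) v" for v
    by (simp add: paid_def pay'_def H_def)
  have "\<exists>F. (\<forall>v x. F v x \<longleftrightarrow> F x v) \<and>
    (\<forall>v\<in>V. card (N v) div 2 \<le> card {x \<in> other N side v. F v x} + paid pay' (same N side) v \<and>
      card {x \<in> other N side v. F v x} + paid pay' (same N side) v \<le> (card (N v) + 1) div 2) \<and>
    avoiding bad' mate' (U True \<union> U False) (\<lambda>v. card {x \<in> other N side v. F v x} + paid pay' (same N side) v)"
  proof (rule cross_factor[OF bal])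
    fix v x assume "x \<in> same N side v"
    then show "pay' v x \<longleftrightarrow> \<not> pay' x v"
      using pay[of x "side v" v] by (simp add: pay'_def H_def same_def)
  next
    show "U True \<union> U False \<subseteq> V" using U(1) by blast
    show "paired (\<lambda>v. card (N v)) mate' (U True \<union> U False)"
      unfolding paired_def
    proof
      fix u assume "u \<in> U True \<union> U False"
      then obtain s where s: "u \<in> U s" by blast
      have "side u = s" "side (mate s u) = s" using U_side s mate_U[OF s] by blast+
      then have "mate' u = mate s u" "mate' (mate s u) = mate s (mate s u)" by (simp_all add: mate'_def)
      moreover have "mate s u \<in> U True \<union> U False" using mate_U[OF s] by (cases s) auto
      ultimately show "odd (card (N u)) \<and> mate' u \<in> U True \<union> U False \<and> mate' u \<noteq> u \<and> mate' (mate' u) = u"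
        using U(2)[of s] s by (simp add: paired_def d_def)
    qed
  qed
  then obtain F where F_sym: "\<And>v x. F v x \<longleftrightarrow> F x v"
    and F: "\<And>v. v \<in> V \<Longrightarrow> d v div 2 \<le> card {x \<in> other N side v. F v x} + paid pay' (same N side) v \<and>
      card {x \<in> other N side v. F v x} + paid pay' (same N side) v \<le> (d v + 1) div 2"
    and F_av: "avoiding bad' mate' (U True \<union> U False)
      (\<lambda>v. card {x \<in> other N side v. F v x} + paid pay' (same N side) v)"
    unfolding d_def by blast
  define p where "p v = card {x \<in> other N side v. F v x}" for v
  have "\<forall>s. \<exists>J. completion {v \<in> V. side v = s} (H s) d s (Z s) p J"
  proof
    fix s
    have "d v div 2 \<le> p v + paid (pay s) (H s) v \<and> p v + paid (pay s) (H s) v \<le> (d v + 1) div 2"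
      if "v \<in> {v \<in> V. side v = s}" for v
      using F[of v] paid'[of v] that by (simp add: p_def)
    moreover have "avoiding (bad s) (mate s) (U s) (\<lambda>v. p v + paid (pay s) (H s) v)"
      unfolding avoiding_def
    proof
      fix u assume u: "u \<in> U s"
      have su: "side u = s" "side (mate s u) = s" using U_side u mate_U[OF u] by blast+
      have "u \<in> U True \<union> U False" using u by (cases s) auto
      then have "p u + paid pay' (same N side) u \<noteq> bad' u \<or>
          p (mate' u) + paid pay' (same N side) (mate' u) \<noteq> bad' (mate' u)"
        using F_av unfolding avoiding_def p_def by blast
      then show "p u + paid (pay s) (H s) u \<noteq> bad s u \<or>
          p (mate s u) + paid (pay s) (H s) (mate s u) \<noteq> bad s (mate s u)"
        using su paid'[of u] paid'[of "mate s u"] by (simp add: mate'_def bad'_def)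
    qed
    ultimately show "\<exists>J. completion {v \<in> V. side v = s} (H s) d s (Z s) p J"
      using plan[of s] unfolding payment_plan_def by blast
  qed
  then obtain J where comp_J: "\<And>s. completion {v \<in> V. side v = s} (H s) d s (Z s) p (J s)" by metis
  have J_sym: "\<And>s v x. J s v x \<longleftrightarrow> J s x v"
    and J: "\<And>s v x. v \<in> V \<Longrightarrow> side v = s \<Longrightarrow> x \<in> H s v \<Longrightarrow>
        round_up s (int (p v + card {x \<in> H s v. J s v x})) \<noteq>
          round_up s (int (p x + card {z \<in> H s x. J s x z}))"
    and J_Z: "\<And>s v. v \<in> Z s \<Longrightarrow> round_up s (int (p v + card {x \<in> H s v. J s v x})) \<noteq> 0"
    using comp_J unfolding completion_def by blast+
  define G where "G v x \<longleftrightarrow> (if side v = side x then J (side v) v x else F v x)" for v x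
  have deg: "card {z \<in> N v. G v z} = p v + card {x \<in> H (side v) v. J (side v) v x}" for v
  proof -
    have "{z \<in> N v. G v z} = {x \<in> other N side v. F v x} \<union> {x \<in> H (side v) v. J (side v) v x}"
    proof (rule set_eqI)
      fix z
      show "z \<in> {z \<in> N v. G v z} \<longleftrightarrow> z \<in> {x \<in> other N side v. F v x} \<union> {x \<in> H (side v) v. J (side v) v x}"
        by (cases "side z = side v") (simp_all add: G_def other_def H_def same_def)
    qed
    moreover have "card ({x \<in> other N side v. F v x} \<union> {x \<in> H (side v) v. J (side v) v x}) =
        card {x \<in> other N side v. F v x} + card {x \<in> H (side v) v. J (side v) v x}"
      by (rule card_Un_disjoint) (auto simp: other_def H_def same_def)
    ultimately show ?thesis by (simp add: p_def)
  qed
  have "round_up (side v) (int (card {z \<in> N v. G v z})) \<noteq> round_up (side x) (int (card {z \<in> N x. G x z}))"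
    if v: "v \<in> V" "x \<in> N v" for v x
  proof (cases "side v = side x")
    case True
    then have "x \<in> H (side v) v" using v by (simp add: H_def same_def)
    then show ?thesis using J[OF v(1) refl] True by (simp add: deg)
  next
    case False
    then show ?thesis by (metis even_round_up)
  qed
  moreover have "G v x \<longleftrightarrow> G x v" for v x using F_sym[of v x] J_sym[of "side v" v x] by (simp add: G_def)
  moreover have "round_up (side v) (int (card {z \<in> N v. G v z})) \<noteq> 0" if "v \<in> Z (side v)" for v
    using J_Z[OF that] by (simp add: deg)
  ultimately show ?thesis by blast
qed

text \<open>\<open>F\<close> will carry the label 2, and \<open>f\<close> is the exponent of 2 at a
  vertex. Neighbours of deleted vertices must avoid 0: on the odd side by parity, on the even side
  because they lie in \<open>Z\<close>.\<close>

lemma exists_proper_factor: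
  assumes deg: "\<And>v. v \<in> V \<Longrightarrow> card (N v) \<le> 6"
  shows "\<exists>F f. (\<forall>v x. F v x \<longleftrightarrow> F x v) \<and>
    (\<forall>v\<in>V. f v \<in> {card {x \<in> N v. F v x}, card {x \<in> N v. F v x} + 1}) \<and>
    (\<forall>v\<in>V. \<forall>x\<in>N v. f v \<noteq> f x)"
proof -
  obtain side where bal: "balanced V N side" using exists_balanced by blast
  define H where "H = same N side"
  define d where "d v = card (N v)" for v
  have two_h: "2 * card (H v) \<le> d v" if "v \<in> V" for v
    using same_le_other[OF bal that] card_same_other[of v side] by (simp add: H_def d_def)
  \<comment> \<open>After deleting a maximal independent set of deep vertices, an odd vertex of the even side
    has at most one odd neighbour there, since the neighbours of deleted vertices become even or isolated.\<close>
  define deep where "deep v \<longleftrightarrow> v \<in> V \<and> side v \<and> d v = 5 \<and> card (H v) = 2 \<and> (\<forall>x\<in>H v. odd (d x))" for v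
  interpret H: nbhd_graph V H unfolding H_def by (rule nbhd_graph_same)
  have "\<exists>I. {} \<subseteq> I \<and> I \<subseteq> {v. deep v} \<and> (\<forall>v\<in>I. H v \<inter> I = {}) \<and> (\<forall>v\<in>{v. deep v} - I. H v \<inter> I \<noteq> {})"
    by (rule H.exists_maximal_independent) (auto simp: deep_def)
  then obtain W where "{} \<subseteq> W \<and> W \<subseteq> {v. deep v} \<and> (\<forall>v\<in>W. H v \<inter> W = {}) \<and> (\<forall>v\<in>{v. deep v} - W. H v \<inter> W \<noteq> {})"
    by (elim exE)
  then have W: "W \<subseteq> {v. deep v}" "\<And>v. v \<in> W \<Longrightarrow> H v \<inter> W = {}"
    "\<And>v. deep v \<Longrightarrow> v \<notin> W \<Longrightarrow> H v \<inter> W \<noteq> {}"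
    by simp_all
  have W_deep: "deep w" if "w \<in> W" for w using W(1) that by blast
  have WV: "W \<subseteq> V" and W_side: "\<And>w. w \<in> W \<Longrightarrow> side w" using W_deep by (auto simp: deep_def)
  have same_W: "N v \<inter> W = H v \<inter> W" if "side v" for v
    using W_side that by (auto simp: H_def same_def)
  have W_indep: "N w \<inter> W = {}" if "w \<in> W" for w using same_W[OF W_side[OF that]] W(2)[OF that] by simp
  let ?N = "delete N W" and ?V = "V - W"
  interpret D: nbhd_graph ?V ?N by (rule nbhd_graph_delete)
  have bal': "balanced ?V ?N side"
  proof (rule balanced_delete[OF bal WV W_indep])
    fix w assume "w \<in> W"
    then have "card (H w) = 2" "d w = 5" using W_deep by (auto simp: deep_def)
    then show "card (other N side w) = card (same N side w) + 1"
      using card_same_other[of w side] by (simp add: H_def d_def)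
  qed
  define d' where "d' v = card (?N v)" for v
  define H' where "H' v = same ?N side v" for v
  have d'_bounds: "d' v \<le> 6" "2 * card (H' v) \<le> d' v" if "v \<in> ?V" for v
  proof -
    have "d' v \<le> card (N v)" unfolding d'_def by (intro card_mono) (auto simp: delete_def)
    then show "d' v \<le> 6" using deg[of v] that by simp
    show "2 * card (H' v) \<le> d' v"
      using D.same_le_other[OF bal' that] D.card_same_other[of v side] by (simp add: H'_def d'_def)
  qed
  define Z where "Z = {v \<in> ?V. side v \<and> H v \<inter> W \<noteq> {}}"
  have reduce: "d' v = d v - card (H v \<inter> W)" "card (H' v) = card (H v) - card (H v \<inter> W)"
    if "v \<in> ?V" "side v" for v
  proof -
    have "?N v = N v - (H v \<inter> W)" using that same_W[OF that(2)] by (auto simp: delete_def)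
    moreover have "H v \<inter> W \<subseteq> N v" by (auto simp: H_def same_def)
    ultimately show "d' v = d v - card (H v \<inter> W)" by (simp add: d'_def d_def card_Diff_subset)
    have "H' v = H v - (H v \<inter> W)" using that by (auto simp: H'_def H_def same_def delete_def)
    then show "card (H' v) = card (H v) - card (H v \<inter> W)" by (simp add: card_Diff_subset)
  qed
  \<comment> \<open>A neighbour of a deep vertex on its side has odd degree. Deletion lowers its
    degree and its number of same-side neighbours equally; if the new degree is odd, an even number
    of these at most two neighbours was deleted, hence both.\<close>
  have Z: "card (H' v) < d' v div 2" "odd (d' v) \<Longrightarrow> H' v = {}" if v: "v \<in> Z" for v
  proof -
    have vV: "v \<in> ?V" "side v" "v \<in> V" using v by (auto simp: Z_def)
    obtain w where w: "w \<in> H v" "w \<in> W" using v by (auto simp: Z_def)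
    then have "odd (d v)" using W_deep[OF w(2)] H.sym[OF w(1)] by (simp add: deep_def)
    moreover have "card (H v \<inter> W) \<ge> 1" using w by (auto simp: Suc_le_eq card_gt_0_iff)
    moreover have "card (H v \<inter> W) \<le> card (H v)" by (intro card_mono) auto
    moreover have "d v \<le> 6" using deg[OF vV(3)] by (simp add: d_def)
    moreover note two_h[OF vV(3)] reduce[OF vV(1,2)]
    ultimately have *: "odd (d v)" "1 \<le> card (H v \<inter> W)" "card (H v \<inter> W) \<le> card (H v)" "d v \<le> 6"
      "2 * card (H v) \<le> d v" "d' v = d v - card (H v \<inter> W)" "card (H' v) = card (H v) - card (H v \<inter> W)"
      by blast+
    have "2 * card (H v) + 1 \<le> d v" using *(1,5) by presburger
    then show "card (H' v) < d' v div 2" using *(2,3,6,7) by linarith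
    have "H' v = {}" if odd: "odd (d' v)"
    proof -
      have "even (card (H v \<inter> W))"
        using *(1,6) odd \<open>2 * card (H v) + 1 \<le> d v\<close> *(3) by (auto simp: even_diff_nat split: if_splits)
      moreover have "card (H v) \<le> 2" using \<open>2 * card (H v) + 1 \<le> d v\<close> *(4) by linarith
      ultimately have "card (H v \<inter> W) = 2" "card (H v) = 2" using *(2,3) by presburger+
      then have "card (H' v) = 0" using *(7) by simp
      then show ?thesis by (simp add: H'_def)
    qed
    then show "odd (d' v) \<Longrightarrow> H' v = {}" .
  qed
  define half where "half s v = (if side v = s then same ?N side v else {})" for s v
  have half: "half s v = H' v" if "side v = s" for s v using that by (simp add: half_def H'_def)
  have graph_half: "nbhd_graph {v \<in> ?V. side v = s} (half s)" for s
    unfolding half_def[abs_def] by (rule D.nbhd_graph_half)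
  have half_bounds: "d' v \<le> 6 \<and> 2 * card (half s v) \<le> d' v" if "v \<in> {v \<in> ?V. side v = s}" for s v
    using d'_bounds[of v] half[of v s] that by simp
  have untouched: "H v \<inter> W = {}" "odd (d v)" "d' v = d v" "H' v = H v"
    if "v \<in> ?V" "side v" "odd (d' v)" "H' v \<noteq> {}" for v
  proof -
    show *: "H v \<inter> W = {}" using Z(2)[of v] that by (auto simp: Z_def)
    then show "d' v = d v" using reduce(1)[OF that(1,2)] by simp
    then show "odd (d v)" using that(3) by simp
    show "H' v = H v" using * that by (auto simp: H'_def H_def same_def delete_def)
  qed
  have "completable {v \<in> ?V. side v = True} (half True) d' True Z"
  proof (rule nbhd_graph.even_side_completable[OF graph_half])
    fix v assume "v \<in> {v \<in> ?V. side v = True}"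
    then show "d' v \<le> 6 \<and> 2 * card (half True v) \<le> d' v" by (rule half_bounds)
  next
    fix v x z assume v: "odd (d' v)" and xz: "x \<in> half True v" "z \<in> half True v" "odd (d' x)" "odd (d' z)"
    interpret T: nbhd_graph "{v \<in> ?V. side v = True}" "half True" by (rule graph_half)
    have inV: "v \<in> ?V" "side v" "x \<in> ?V" "side x" "z \<in> ?V" "side z"
      using T.nbhd_in[OF T.sym[OF xz(1)]] T.nbhd_in[OF xz(1)] T.nbhd_in[OF xz(2)] by auto
    have H': "x \<in> H' v" "z \<in> H' v" "v \<in> H' x" "v \<in> H' z"
      using xz(1,2) T.sym[OF xz(1)] T.sym[OF xz(2)] half inV by auto
    have v': "H v \<inter> W = {}" "odd (d v)" "d' v = d v" "H' v = H v"
      using untouched[OF inV(1,2) v] H'(1) by blast+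
    have odd_xz: "odd (d x)" "odd (d z)"
      using untouched(2)[OF inV(3,4) xz(3)] untouched(2)[OF inV(5,6) xz(4)] H' by blast+
    show "x = z"
    proof (rule ccontr)
      assume "x \<noteq> z"
      have sub: "{x, z} \<subseteq> H v" using H' v' by auto
      have "card {x, z} \<le> card (H v)" by (rule card_mono[OF _ sub]) simp
      then have "2 \<le> card (H v)" using \<open>x \<noteq> z\<close> by simp
      moreover have "2 * card (H v) \<le> d v" "d v \<le> 6" using two_h[of v] deg[of v] inV by (auto simp: d_def)
      \<comment> \<open>Oddness and the bound 6 leave degree 5 with just the odd neighbours
        \<open>x\<close> and \<open>z\<close>. So \<open>v\<close> is deep without a neighbour in
        \<open>W\<close>, against the maximality of \<open>W\<close>.\<close>
      ultimately have *: "card (H v) = 2" "d v = 5" using v'(2) by presburger+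
      have "{x, z} = H v"
        by (rule card_subset_eq[OF _ sub]) (use \<open>x \<noteq> z\<close> *(1) in simp_all)
      then have "\<forall>u\<in>H v. odd (d u)" using odd_xz by (metis empty_iff insert_iff)
      then have "deep v" unfolding deep_def using inV * by simp
      then show False using W(3)[of v] v'(1) inV(1) by blast
    qed
  next
    fix v assume v: "v \<in> Z"
    then show "v \<in> {v \<in> ?V. side v = True} \<and> card (half True v) < d' v div 2 \<and> (odd (d' v) \<longrightarrow> half True v = {})"
      using Z[OF v] half[of v True] by (simp add: Z_def)
  qed
  moreover have "completable {v \<in> ?V. side v = False} (half False) d' False {}"
    by (rule nbhd_graph.odd_side_completable[OF graph_half half_bounds])
  ultimately have "completable {v \<in> ?V. side v = s} (half s) d' s (if s then Z else {})" for s
    by (cases s) simp_all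
  then have "\<exists>F. (\<forall>v x. F v x \<longleftrightarrow> F x v) \<and>
    (\<forall>v\<in>?V. \<forall>x\<in>?N v. round_up (side v) (int (card {z \<in> ?N v. F v z})) \<noteq>
      round_up (side x) (int (card {z \<in> ?N x. F x z}))) \<and>
    (\<forall>v\<in>?V. v \<in> (if side v then Z else {}) \<longrightarrow> round_up (side v) (int (card {z \<in> ?N v. F v z})) \<noteq> 0)"
    unfolding half_def[abs_def] d'_def[abs_def] by (rule D.completable_sides[OF bal'])
  then obtain F where F_all: "(\<forall>v x. F v x \<longleftrightarrow> F x v) \<and>
    (\<forall>v\<in>?V. \<forall>x\<in>?N v. round_up (side v) (int (card {z \<in> ?N v. F v z})) \<noteq>
      round_up (side x) (int (card {z \<in> ?N x. F x z}))) \<and>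
    (\<forall>v\<in>?V. v \<in> (if side v then Z else {}) \<longrightarrow> round_up (side v) (int (card {z \<in> ?N v. F v z})) \<noteq> 0)"
    by (elim exE)
  have F_sym: "F v x \<longleftrightarrow> F x v" for v x using F_all by blast
  have F: "round_up (side v) (int (card {z \<in> ?N v. F v z})) \<noteq>
      round_up (side x) (int (card {z \<in> ?N x. F x z}))" if "v \<in> ?V" "x \<in> ?N v" for v x
    using F_all that by blast
  have F_Z: "round_up (side v) (int (card {z \<in> ?N v. F v z})) \<noteq> 0" if "v \<in> Z" for v
  proof -
    have "v \<in> ?V" "side v" using that by (auto simp: Z_def)
    moreover have "v \<in> (if side v then Z else {})" using that \<open>side v\<close> by simp
    ultimately show ?thesis using F_all by blast
  qed
  define G where "G v x \<longleftrightarrow> v \<notin> W \<and> x \<notin> W \<and> F v x" for v x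
  define c where "c v = card {z \<in> N v. G v z}" for v
  have c: "c v = card {z \<in> ?N v. F v z}" if "v \<notin> W" for v
    unfolding c_def by (rule arg_cong[where f = card]) (use that in \<open>auto simp: G_def delete_def\<close>)
  define f where "f v = (if v \<in> W then 0 else nat (round_up (side v) (int (c v))))" for v
  have int_f: "int (f v) = round_up (side v) (int (c v))" if "v \<notin> W" for v
    using round_up_of_nat[of "side v" "c v"] that by (auto simp: f_def)
  have f_values: "f v \<in> {c v, c v + 1}" for v
  proof (cases "v \<in> W")
    case True
    then have "c v = 0" by (simp add: c_def G_def)
    then show ?thesis using True by (simp add: f_def)
  next
    case False
    then show ?thesis using round_up_of_nat[of "side v" "c v"] int_f[OF False] by auto
  qed
  have f_nonzero: "f x \<noteq> 0" if w: "w \<in> W" and x: "x \<in> N w" for w x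
  proof -
    have xW: "x \<notin> W" "x \<in> V" using W_indep[OF w] x nbhd_in by auto
    have "round_up (side x) (int (c x)) \<noteq> 0"
    proof (cases "side x")
      case True
      then have "w \<in> H x" using sym[OF x] W_side[OF w] by (simp add: H_def same_def)
      then have "x \<in> Z" using xW True w by (auto simp: Z_def)
      then show ?thesis using F_Z[of x] xW c[OF xW(1)] by simp
    next
      case False
      then have "odd (round_up (side x) (int (c x)))" by (simp add: even_round_up)
      then show ?thesis by (metis even_zero)
    qed
    then show ?thesis using int_f[OF xW(1)] by (metis of_nat_0)
  qed
  have "f v \<noteq> f x" if x: "v \<in> V" "x \<in> N v" for v x
  proof (cases "v \<in> W \<or> x \<in> W")
    case True
    then show ?thesis
    proof
      assume "v \<in> W"
      then show ?thesis using f_nonzero[OF _ x(2)] by (auto simp: f_def)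
    next
      assume "x \<in> W"
      then show ?thesis using f_nonzero[OF _ sym[OF x(2)]] by (auto simp: f_def)
    qed
  next
    case False
    then have "v \<in> ?V" "x \<in> ?N v" using x by (auto simp: delete_def)
    then show ?thesis using F[of v x] c int_f False by metis
  qed
  moreover have "G v x \<longleftrightarrow> G x v" for v x using F_sym[of v x] by (auto simp: G_def)
  ultimately show ?thesis using f_values unfolding c_def by blast
qed

end

section \<open>From edge sets and exponents to labellings\<close>

lemma prod_two_or_one:
  assumes "finite A"
  shows "(\<Prod>x\<in>A. if P x then 2 else (1 :: nat)) = 2 ^ card {x \<in> A. P x}"
proof -
  have "(\<Prod>x\<in>{x \<in> A. P x}. 2 :: nat) = (\<Prod>x\<in>A. if P x then 2 else 1)"
    by (rule prod.inter_filter[OF assms])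
  then show ?thesis by (simp add: prod_constant)
qed

context fin_simple_graph
begin

lemma nbhd_graph_neighbours: "nbhd_graph V (neighbours E)"
proof
  show "finite V" by (rule finite_vertices)
  show "neighbours E v \<subseteq> V" for v using edges by (auto simp: neighbours_def)
  show "v \<notin> neighbours E v" for v using edges[of "{v, v}"] by (auto simp: neighbours_def)
  show "v \<in> neighbours E x" if "x \<in> neighbours E v" for x v
    using that by (simp add: neighbours_def insert_commute)
qed

lemma label_product_eq:
  "label_product E l w = l (Inl w) * (\<Prod>x\<in>neighbours E w. l (Inr {w, x}))"
proof -
  have "{e \<in> E. w \<in> e} = (\<lambda>x. {w, x}) ` neighbours E w"
  proof (rule set_eqI)
    fix e
    have "\<exists>x. e = {w, x}" if "e \<in> E" "w \<in> e"
      using edges[OF that(1)] that(2) by (auto simp: card_2_iff)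
    then show "e \<in> {e \<in> E. w \<in> e} \<longleftrightarrow> e \<in> (\<lambda>x. {w, x}) ` neighbours E w"
      by (auto simp: neighbours_def)
  qed
  moreover have "inj_on (\<lambda>x. {w, x}) (neighbours E w)" by (auto simp: inj_on_def doubleton_eq_iff)
  ultimately show ?thesis by (simp add: label_product_def prod.reindex)
qed

lemma total_product_chromatic_number_le:
  assumes "total_labelling V E k l" "product_proper E l" "k \<ge> 1"
  shows "total_product_chromatic_number V E \<le> k"
  unfolding total_product_chromatic_number_def using assms by (intro Least_le) blast

end

theorem theorem1p3:
  fixes V :: "'a set" and E :: "'a set set"
  assumes "fin_simple_graph V E"
    and "max_degree V E = 6"
  shows "total_product_chromatic_number V E \<le> 2 \<and>
    (\<exists>l :: 'a + 'a set \<Rightarrow> nat. l \<in> (V <+> E) \<rightarrow> {1, 2} \<and>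
      (\<forall>u v. {u, v} \<in> E \<longrightarrow>
        l (Inl u) * (\<Prod>x\<in>neighbours E u. l (Inr {u, x})) \<noteq>
        l (Inl v) * (\<Prod>x\<in>neighbours E v. l (Inr {v, x}))))"
proof -
  interpret fin_simple_graph V E by (rule assms(1))
  interpret nbhd_graph V "neighbours E" by (rule nbhd_graph_neighbours)
  have deg: "card (neighbours E v) \<le> 6" if "v \<in> V" for v
  proof -
    have "degree E v \<le> max_degree V E"
      unfolding max_degree_def by (rule Max_ge) (use that finite_V in auto)
    then show ?thesis using assms(2) by (simp add: degree_def)
  qed
  have "\<exists>F f. (\<forall>v x. F v x \<longleftrightarrow> F x v) \<and>
    (\<forall>v\<in>V. f v \<in> {card {x \<in> neighbours E v. F v x}, card {x \<in> neighbours E v. F v x} + 1}) \<and>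
    (\<forall>v\<in>V. \<forall>x\<in>neighbours E v. f v \<noteq> f x)"
    by (rule exists_proper_factor) (rule deg)
  then obtain F f where "(\<forall>v x. F v x \<longleftrightarrow> F x v) \<and>
    (\<forall>v\<in>V. f v \<in> {card {x \<in> neighbours E v. F v x}, card {x \<in> neighbours E v. F v x} + 1}) \<and>
    (\<forall>v\<in>V. \<forall>x\<in>neighbours E v. f v \<noteq> f x)"
    by (elim exE)
  then have F_sym: "\<forall>v x. F v x \<longleftrightarrow> F x v"
    and f: "\<forall>v\<in>V. f v \<in> {card {x \<in> neighbours E v. F v x}, card {x \<in> neighbours E v. F v x} + 1}"
    and proper: "\<forall>v\<in>V. \<forall>x\<in>neighbours E v. f v \<noteq> f x"
    by blast+
  \<comment> \<open>A vertex gets label 2 exactly when \<open>f v\<close> is not the number of its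
    edges in \<open>F\<close>; at each vertex of \<open>V\<close> the product is then
    \<open>2 ^ f v\<close>.\<close>
  define l :: "'a + 'a set \<Rightarrow> nat" where
    "l = case_sum (\<lambda>v. if f v = card {x \<in> neighbours E v. F v x} then 1 else 2)
      (\<lambda>e. if \<exists>v x. e = {v, x} \<and> F v x then 2 else 1)"
  have l_edge: "l (Inr {v, x}) = (if F v x then 2 else 1)" for v x
  proof -
    have "(\<exists>v' x'. {v, x} = {v', x'} \<and> F v' x') \<longleftrightarrow> F v x"
      using F_sym by (auto simp: doubleton_eq_iff)
    then show ?thesis by (simp add: l_def)
  qed
  have product: "l (Inl v) * (\<Prod>x\<in>neighbours E v. l (Inr {v, x})) = 2 ^ f v" if "v \<in> V" for v
  proof -
    have "f v = card {x \<in> neighbours E v. F v x} \<or> f v = card {x \<in> neighbours E v. F v x} + 1"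
      using f that by blast
    moreover have "(\<Prod>x\<in>neighbours E v. l (Inr {v, x})) = 2 ^ card {x \<in> neighbours E v. F v x}"
      by (simp add: l_edge prod_two_or_one)
    ultimately show ?thesis by (auto simp: l_def)
  qed
  have "l x \<in> {1, 2}" for x by (cases x) (simp_all only: l_def sum.case split: if_split, simp_all)
  then have l_range: "l \<in> (V <+> E) \<rightarrow> {1, 2}" by (rule Pi_I)
  have l_proper: "l (Inl u) * (\<Prod>x\<in>neighbours E u. l (Inr {u, x})) \<noteq>
      l (Inl v) * (\<Prod>x\<in>neighbours E v. l (Inr {v, x}))" if "{u, v} \<in> E" for u v
  proof -
    have uv: "v \<in> neighbours E u" "u \<in> V" "v \<in> V" using that edges[OF that] by (auto simp: neighbours_def)
    then have "f u \<noteq> f v" using proper by blast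
    then show ?thesis using product[OF uv(2)] product[OF uv(3)] by simp
  qed
  have "{1..2} = {1, 2 :: nat}" by auto
  then have "total_labelling V E 2 l" using l_range by (simp add: total_labelling_def)
  moreover have "product_proper E l" using l_proper by (simp add: product_proper_def label_product_eq)
  ultimately have "total_product_chromatic_number V E \<le> 2"
    by (rule total_product_chromatic_number_le) simp
  then show ?thesis using l_range l_proper by blast
qed

end
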